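(* There is an explicit (deterministic) family of $3$-regular expander graphs on which the simple random walk, from a worst-case initial position, does not exhibit total-variation cutoff. That is, there are an explicit sequence $(G_k)_{k\ge1}$ of finite $3$-regular graphs with $|V(G_k)|\to\infty$ and a constant $c>0$ such that $\mathrm{ch}(G_k)>c$ for all $k$, and such that it is not the case that \[\lim_{k\to\infty}\frac{t_{\mathrm{mix}}^{(k)}(\epsilon)}{t_{\mathrm{mix}}^{(k)}(1-\epsilon)}=1\quad\text{for every }0<\epsilon<1 .\]
   Context: For a finite regular graph $G$, the Cheeger constant is $\mathrm{ch}(G)=\min_{\emptyset\ne S\subsetneq V(G)}\frac{|\partial S|}{\min(|S|,|V(G)\setminus S|)}$, where $\partial S$ is the set of edges with exactly one endpoint in $S$. A family of bounded-degree graphs is a family of expanders if there is a fixed $c>0$ with $\mathrm{ch}(G)>c$ for all members. The simple random walk (SRW) on $G$ is the discrete-time Markov chain moving at each step to a uniformly chosen neighbor. For an aperiodic irreducible discrete-time chain $(X_t)$ on a finite state space $\Omega$ with stationary distribution $\pi$, let $d(t)=\max_{x\in\Omega}\|\mathbb P_x(X_t\in\cdot)-\pi\|_{\mathrm{TV}}$, where $\|\mu-\nu\|_{\mathrm{TV}}=\frac12\sum_x|\mu(x)-\nu(x)|$, and $t_{\mathrm{mix}}(\epsilon)=\min\{t:d(t)<\epsilon\}$ for $0<\epsilon<1$. The quantity $t_{\mathrm{mix}}^{(k)}(\epsilon)$ is this mixing time for the SRW on $G_k$. (The SRW on the graphs in question is understood to be irreducible and aperiodic.) "Explicit" means given by a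 deterministic construction (as opposed to a random one). *)

theory Defs
  imports "HOL-Probability.Probability" "Graph_Theory.Pair_Digraph"
begin

text \<open>
  Finite simple graphs are digraphs without parallel arcs satisfying the locale
  predicate \<open>pair_graph\<close> (finite, loop-free, symmetric); the edge \<open>{u, v}\<close> is
  represented by the two arcs \<open>(u, v)\<close> and \<open>(v, u)\<close>.
\<close>

definition neighbours :: "'a pair_pre_digraph \<Rightarrow> 'a \<Rightarrow> 'a set" where
  "neighbours G u = {v. (u, v) \<in> parcs G}"

definition regular_graph :: "nat \<Rightarrow> 'a pair_pre_digraph \<Rightarrow> bool" where
  "regular_graph d G \<longleftrightarrow>
     pair_graph G \<and> pverts G \<noteq> {} \<and> (\<forall>u\<in>pverts G. card (neighbours G u) = d)"

section \<open>Cheeger constant and expanders\<close>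

text \<open>Boundary edges are undirected, so each is counted once.\<close>

definition edge_boundary :: "'a pair_pre_digraph \<Rightarrow> 'a set \<Rightarrow> 'a set set" where
  "edge_boundary G S = {{u, v} | u v. (u, v) \<in> parcs G \<and> u \<in> S \<and> v \<notin> S}"

definition cheeger :: "'a pair_pre_digraph \<Rightarrow> real" where
  "cheeger G =
     Min ((\<lambda>S. real (card (edge_boundary G S)) /
                real (min (card S) (card (pverts G - S))))
          ` {S. S \<noteq> {} \<and> S \<subset> pverts G})"

definition expander_family :: "(nat \<Rightarrow> 'a pair_pre_digraph) \<Rightarrow> bool" where
  "expander_family G \<longleftrightarrow> (\<exists>c>0. \<forall>k. cheeger (G k) > c)"

section \<open>Finite Markov chains, mixing and cutoff\<close>

text \<open>
  A chain is given by its finite state space \<open>\<Omega>\<close> and its transition kernel \<open>K\<close>, which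
  is only relevant on \<open>\<Omega>\<close>.
\<close>

definition chain_dist :: "('a \<Rightarrow> 'a pmf) \<Rightarrow> 'a \<Rightarrow> nat \<Rightarrow> 'a pmf" where
  "chain_dist K x t = ((\<lambda>\<mu>. bind_pmf \<mu> K) ^^ t) (return_pmf x)"

definition irreducible_chain :: "'a set \<Rightarrow> ('a \<Rightarrow> 'a pmf) \<Rightarrow> bool" where
  "irreducible_chain \<Omega> K \<longleftrightarrow>
     (\<forall>x\<in>\<Omega>. \<forall>y\<in>\<Omega>. \<exists>t. pmf (chain_dist K x t) y > 0)"

definition aperiodic_chain :: "'a set \<Rightarrow> ('a \<Rightarrow> 'a pmf) \<Rightarrow> bool" where
  "aperiodic_chain \<Omega> K \<longleftrightarrow>
     (\<forall>x\<in>\<Omega>. Gcd {t. t > 0 \<and> pmf (chain_dist K x t) x > 0} = 1)"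

definition stationary_dist :: "'a set \<Rightarrow> ('a \<Rightarrow> 'a pmf) \<Rightarrow> 'a pmf" where
  "stationary_dist \<Omega> K = (THE \<pi>. set_pmf \<pi> \<subseteq> \<Omega> \<and> bind_pmf \<pi> K = \<pi>)"

definition tv_dist :: "'a set \<Rightarrow> 'a pmf \<Rightarrow> 'a pmf \<Rightarrow> real" where
  "tv_dist \<Omega> \<mu> \<nu> = 1 / 2 * (\<Sum>x\<in>\<Omega>. \<bar>pmf \<mu> x - pmf \<nu> x\<bar>)"

definition worst_dist :: "'a set \<Rightarrow> ('a \<Rightarrow> 'a pmf) \<Rightarrow> nat \<Rightarrow> real" where
  "worst_dist \<Omega> K t =
     Max ((\<lambda>x. tv_dist \<Omega> (chain_dist K x t) (stationary_dist \<Omega> K)) ` \<Omega>)"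

definition t_mix :: "'a set \<Rightarrow> ('a \<Rightarrow> 'a pmf) \<Rightarrow> real \<Rightarrow> nat" where
  "t_mix \<Omega> K \<epsilon> = (LEAST t. worst_dist \<Omega> K t < \<epsilon>)"

definition tv_cutoff :: "(nat \<Rightarrow> 'a set) \<Rightarrow> (nat \<Rightarrow> 'a \<Rightarrow> 'a pmf) \<Rightarrow> bool" where
  "tv_cutoff \<Omega> K \<longleftrightarrow>
     (\<forall>\<epsilon>. 0 < \<epsilon> \<and> \<epsilon> < 1 \<longrightarrow>
        (\<lambda>k. real (t_mix (\<Omega> k) (K k) \<epsilon>) / real (t_mix (\<Omega> k) (K k) (1 - \<epsilon>)))
          \<longlonglongrightarrow> 1)"

definition srw :: "'a pair_pre_digraph \<Rightarrow> 'a \<Rightarrow> 'a pmf" where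
  "srw G u = pmf_of_set (neighbours G u)"

section \<open>Explicit families\<close>

text \<open>
  The total recursive functions: \<open>recursive_fun n f\<close> says that \<open>f\<close>, restricted to
  argument lists of length \<open>n\<close>, is an \<open>n\<close>-ary total recursive function.
  Minimisation is only applied to regular functions, hence all functions are total.
\<close>

inductive recursive_fun :: "nat \<Rightarrow> (nat list \<Rightarrow> nat) \<Rightarrow> bool" where
  zero: "recursive_fun n (\<lambda>xs. 0)"
| succ: "recursive_fun 1 (\<lambda>xs. Suc (xs ! 0))"
| proj: "i < n \<Longrightarrow> recursive_fun n (\<lambda>xs. xs ! i)"
| comp: "recursive_fun (length gs) f \<Longrightarrow> \<forall>g\<in>set gs. recursive_fun n g \<Longrightarrow>
    recursive_fun n (\<lambda>xs. f (map (\<lambda>g. g xs) gs))"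
| prec: "recursive_fun n f \<Longrightarrow> recursive_fun (n + 2) g \<Longrightarrow>
    recursive_fun (Suc n)
      (\<lambda>xs. rec_nat (f (tl xs)) (\<lambda>y r. g (y # r # tl xs)) (hd xs))"
| minim: "recursive_fun (Suc n) f \<Longrightarrow>
    (\<And>xs. length xs = n \<Longrightarrow> \<exists>y. f (y # xs) = 0) \<Longrightarrow>
    recursive_fun n (\<lambda>xs. LEAST y. f (y # xs) = 0)"
| cong: "recursive_fun n f \<Longrightarrow> (\<And>xs. length xs = n \<Longrightarrow> f xs = g xs) \<Longrightarrow>
    recursive_fun n g"

text \<open>
  A family is explicit if a deterministic algorithm outputs, on input \<open>k\<close>, the \<open>k\<close>-th
  graph: its number of vertices (the vertices being numbered from 0) and its adjacency
  matrix are recursive functions.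
\<close>

definition explicit_family :: "(nat \<Rightarrow> nat pair_pre_digraph) \<Rightarrow> bool" where
  "explicit_family G \<longleftrightarrow>
     (\<exists>N A. recursive_fun 1 N \<and> recursive_fun 3 A \<and>
        (\<forall>k. pverts (G k) = {..<N [k]} \<and>
             parcs (G k) = {(u, v). u < N [k] \<and> v < N [k] \<and> A [k, u, v] = 1}))"

end

(*
  The Cheeger constant does not see eigenvalues of the walk near -1, so a 3-regular expander may be
  bipartite up to boundedly many edges. On n vertices, such a graph remembers the parity of the
  starting point for a time of order n: the distance to equilibrium stays near 1/2 up to then.
  It falls below 1 by a fixed amount much earlier: the lazy walk mixes in logarithmic time,
  and the return probabilities at even times are decreasing, so they are at most twice the lazy ones;
  hence they are O(1/n), which forces an overlap with the uniform distribution.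

  The expander replaces every point of the torus (Z/m)^2 by an 8-cycle whose vertices are the ends
  of the edges (x, y) - (x + y, y), (x, x + y), (x + 1, y), (x, y + 1); the spectral gap of the torus
  graph follows by Fourier analysis.
*)

theory Submission
  imports Defs "HOL-Number_Theory.Cong" "HOL-Real_Asymp.Real_Asymp"
begin

section \<open>Total recursive functions\<close>

text \<open>Cutoff is refuted at the single value \<epsilon> = 1/5: the parity argument works for
  any level below 1/2, the overlap argument for any level above 3/4, and 1/5 and 1 - 1/5 satisfy
  both. With n = 8 m^2 vertices, the mixing time at 1/5 exceeds (8/5) m^2, while at 4/5 it is at
  most m for large m. An exactly bipartite walk would be periodic, so one odd cycle is built in, at
  the cost of two edges that join equal parities. All quantitative expansion enters through one
  Poincare inequality, with the unoptimised constant 10^6. It gives the contraction of the lazy walk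
  and the Cheeger bound, and also connectedness and uniqueness of the stationary law. A further
  point is hidden in the definition of \<open>t_mix\<close> as a \<open>LEAST\<close>: a lower bound
  on it is meaningful only if some time reaches the level at all, so convergence of the chain is
  proved separately, without any rate. Explicitness means recursive functions of vertex numbers; the
  graph is therefore coded by \<open>div\<close> and \<open>mod\<close>.\<close>

lemma rec_const: "recursive_fun n (\<lambda>xs. c)"
proof (induction c)
  case (Suc c)
  have "recursive_fun n (\<lambda>xs. (\<lambda>ys. Suc (ys ! 0)) (map (\<lambda>g. g xs) [\<lambda>xs. c]))"
    by (rule recursive_fun.comp) (use Suc recursive_fun.succ in auto)
  then show ?case by simp
qed (rule recursive_fun.zero)

lemma rec_app1:
  assumes "recursive_fun 1 f" "recursive_fun n a"
  shows "recursive_fun n (\<lambda>xs. f [a xs])"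
proof -
  have "recursive_fun n (\<lambda>xs. f (map (\<lambda>g. g xs) [a]))"
    by (rule recursive_fun.comp) (use assms in auto)
  then show ?thesis by simp
qed

lemma rec_app2:
  assumes "recursive_fun 2 f" "recursive_fun n a" "recursive_fun n b"
  shows "recursive_fun n (\<lambda>xs. f [a xs, b xs])"
proof -
  have "recursive_fun n (\<lambda>xs. f (map (\<lambda>g. g xs) [a, b]))"
    by (rule recursive_fun.comp) (use assms in \<open>auto simp: numeral_2_eq_2\<close>)
  then show ?thesis by simp
qed

lemma rec_Suc: "recursive_fun n a \<Longrightarrow> recursive_fun n (\<lambda>xs. Suc (a xs))"
  using rec_app1[OF recursive_fun.succ] by simp

lemma rec_add:
  assumes "recursive_fun n a" "recursive_fun n b" shows "recursive_fun n (\<lambda>xs. a xs + b xs)"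
proof -
  have "recursive_fun (Suc 1)
      (\<lambda>xs. rec_nat ((\<lambda>ys. ys ! 0) (tl xs)) (\<lambda>y r. (\<lambda>ys. Suc (ys ! 1)) (y # r # tl xs)) (hd xs))"
    by (rule recursive_fun.prec) (auto intro!: recursive_fun.proj rec_Suc)
  moreover have "rec_nat c (\<lambda>y. Suc) k = k + c" for c k by (induction k) auto
  ultimately have "recursive_fun 2 (\<lambda>xs. hd xs + tl xs ! 0)"
    by (simp add: numeral_2_eq_2)
  from rec_app2[OF this assms] show ?thesis by simp
qed

lemma rec_mult:
  assumes "recursive_fun n a" "recursive_fun n b" shows "recursive_fun n (\<lambda>xs. a xs * b xs)"
proof -
  have "recursive_fun (Suc 1)
      (\<lambda>xs. rec_nat ((\<lambda>ys. 0) (tl xs)) (\<lambda>y r. (\<lambda>ys. ys ! 1 + ys ! 2) (y # r # tl xs)) (hd xs))"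
    by (rule recursive_fun.prec) (auto intro!: recursive_fun.proj recursive_fun.zero rec_add)
  moreover have "rec_nat 0 (\<lambda>y r. r + c) k = k * c" for c k :: nat by (induction k) auto
  ultimately have "recursive_fun 2 (\<lambda>xs. hd xs * tl xs ! 0)"
    by (simp add: numeral_2_eq_2)
  from rec_app2[OF this assms] show ?thesis by simp
qed

lemma rec_pred: "recursive_fun n a \<Longrightarrow> recursive_fun n (\<lambda>xs. a xs - 1)"
proof -
  assume a: "recursive_fun n a"
  have "recursive_fun (Suc 0)
      (\<lambda>xs. rec_nat ((\<lambda>ys. 0) (tl xs)) (\<lambda>y r. (\<lambda>ys. ys ! 0) (y # r # tl xs)) (hd xs))"
    by (rule recursive_fun.prec) (auto intro!: recursive_fun.proj recursive_fun.zero)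
  moreover have "rec_nat 0 (\<lambda>y r. y) k = k - 1" for k :: nat by (cases k) auto
  ultimately have "recursive_fun 1 (\<lambda>xs. hd xs - 1)" by simp
  from rec_app1[OF this a] show ?thesis by simp
qed

lemma rec_diff:
  assumes "recursive_fun n a" "recursive_fun n b" shows "recursive_fun n (\<lambda>xs. a xs - b xs)"
proof -
  have "recursive_fun (Suc 1)
      (\<lambda>xs. rec_nat ((\<lambda>ys. ys ! 0) (tl xs)) (\<lambda>y r. (\<lambda>ys. ys ! 1 - 1) (y # r # tl xs)) (hd xs))"
    by (rule recursive_fun.prec) (auto intro!: recursive_fun.proj rec_pred[unfolded One_nat_def])
  moreover have "rec_nat c (\<lambda>y r. r - Suc 0) k = c - k" for c k :: nat by (induction k) auto
  ultimately have "recursive_fun 2 (\<lambda>xs. tl xs ! 0 - hd xs)"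
    by (simp add: numeral_2_eq_2)
  from rec_app2[OF this assms(2,1)] show ?thesis by simp
qed

text \<open>Predicates are carried as \<open>of_bool\<close>-valued functions: negation is
  subtraction from 1, conjunction a product, and comparison a truncated difference.\<close>

lemma rec_not: "recursive_fun n (\<lambda>xs. of_bool (p xs)) \<Longrightarrow> recursive_fun n (\<lambda>xs. of_bool (\<not> p xs))"
  by (rule recursive_fun.cong[OF rec_diff[OF rec_const[of n 1], of "\<lambda>xs. of_bool (p xs)"]]) auto

lemma rec_conj:
  "recursive_fun n (\<lambda>xs. of_bool (p xs)) \<Longrightarrow> recursive_fun n (\<lambda>xs. of_bool (q xs)) \<Longrightarrow>
   recursive_fun n (\<lambda>xs. of_bool (p xs \<and> q xs))"
  by (rule recursive_fun.cong[OF rec_mult[of n "\<lambda>xs. of_bool (p xs)" "\<lambda>xs. of_bool (q xs)"]]) auto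

lemma rec_disj:
  "recursive_fun n (\<lambda>xs. of_bool (p xs)) \<Longrightarrow> recursive_fun n (\<lambda>xs. of_bool (q xs)) \<Longrightarrow>
   recursive_fun n (\<lambda>xs. of_bool (p xs \<or> q xs))"
  using rec_not[OF rec_conj[OF rec_not rec_not]] by simp

lemma rec_le:
  "recursive_fun n a \<Longrightarrow> recursive_fun n b \<Longrightarrow> recursive_fun n (\<lambda>xs. of_bool (a xs \<le> b xs))"
  by (rule recursive_fun.cong[OF rec_diff[OF rec_const[of n 1] rec_diff[of n a b]]]) auto

lemma rec_less:
  "recursive_fun n a \<Longrightarrow> recursive_fun n b \<Longrightarrow> recursive_fun n (\<lambda>xs. of_bool (a xs < b xs))"
  using rec_not[OF rec_le[of n b a]] by (simp add: not_le)

lemma rec_eq: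
  "recursive_fun n a \<Longrightarrow> recursive_fun n b \<Longrightarrow> recursive_fun n (\<lambda>xs. of_bool (a xs = b xs))"
  using rec_conj[OF rec_le[of n a b] rec_le[of n b a]] by (simp add: eq_iff)

lemma rec_if:
  "recursive_fun n (\<lambda>xs. of_bool (p xs)) \<Longrightarrow> recursive_fun n a \<Longrightarrow> recursive_fun n b \<Longrightarrow>
   recursive_fun n (\<lambda>xs. if p xs then a xs else b xs)"
  by (rule recursive_fun.cong[OF rec_add[OF rec_mult[of n "\<lambda>xs. of_bool (p xs)" a]
        rec_mult[OF rec_not[of n p], of b]]]) auto

text \<open>Minimisation prepends the search variable, so functions of the original arguments have
  to be read off the tail.\<close>

lemma rec_tl:
  assumes "recursive_fun n a" shows "recursive_fun (Suc n) (\<lambda>xs. a (tl xs))"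
proof -
  have "recursive_fun (Suc n) (\<lambda>xs. a (map (\<lambda>g. g xs) (map (\<lambda>i xs. xs ! Suc i) [0..<n])))"
    by (rule recursive_fun.comp) (use assms in \<open>auto intro!: recursive_fun.proj\<close>)
  then show ?thesis
  proof (rule recursive_fun.cong)
    fix xs :: "nat list" assume "length xs = Suc n"
    then have "map (\<lambda>i. xs ! Suc i) [0..<n] = tl xs"
      by (intro nth_equalityI) (auto simp: nth_tl)
    then show "a (map (\<lambda>g. g xs) (map (\<lambda>i xs. xs ! Suc i) [0..<n])) = a (tl xs)"
      by (simp add: comp_def)
  qed
qed

text \<open>The quotient is the least \<open>y\<close> with \<open>a < Suc y * b\<close>. The
  disjunct for a zero divisor keeps the search total and yields 0, the value of division by
  zero.\<close>

lemma rec_div: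
  assumes "recursive_fun n a" "recursive_fun n b" shows "recursive_fun n (\<lambda>xs. a xs div b xs)"
proof -
  let ?f = "\<lambda>ys. 1 - of_bool (b (tl ys) = 0 \<or> a (tl ys) < Suc (ys ! 0) * b (tl ys)) :: nat"
  have f0: "?f (y # xs) = 0 \<longleftrightarrow> b xs = 0 \<or> a xs div b xs \<le> y" for y xs
    by (cases "b xs = 0") (auto simp: div_less_iff_less_mult simp flip: less_Suc_eq_le)
  have "recursive_fun n (\<lambda>xs. LEAST y. ?f (y # xs) = 0)"
  proof (rule recursive_fun.minim)
    show "recursive_fun (Suc n) ?f"
      using assms by (intro rec_diff rec_disj rec_eq rec_less rec_mult rec_Suc rec_tl rec_const
          recursive_fun.proj) auto
    show "\<exists>y. ?f (y # xs) = 0" for xs unfolding f0 by blast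
  qed
  moreover have "(LEAST y. ?f (y # xs) = 0) = a xs div b xs" for xs
    unfolding f0 by (cases "b xs = 0") (auto intro!: Least_equality)
  ultimately show ?thesis by simp
qed

lemma rec_mod:
  assumes "recursive_fun n a" "recursive_fun n b" shows "recursive_fun n (\<lambda>xs. a xs mod b xs)"
  unfolding modulo_nat_def using assms by (intro rec_diff rec_mult rec_div)

lemmas rec_intros = rec_const rec_Suc rec_if rec_conj rec_disj rec_not rec_eq rec_less rec_le
  rec_add rec_mult rec_diff rec_div rec_mod

section \<open>Spectral gap of the torus graph\<close>

definition charz :: "nat \<Rightarrow> int \<Rightarrow> complex" where
  "charz m a = cis (2 * pi * real_of_int a / real m)"

lemma charz_add: "charz m (a + b) = charz m a * charz m b"
  by (simp add: charz_def cis_mult add_divide_distrib distrib_left)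

lemma charz_0 [simp]: "charz m 0 = 1"
  by (simp add: charz_def)

lemma norm_charz [simp]: "norm (charz m a) = 1"
  by (simp add: charz_def)

lemma cnj_charz: "cnj (charz m a) = charz m (- a)"
  by (simp add: charz_def cis_cnj)

lemma charz_power: "charz m a ^ k = charz m (a * int k)"
  by (simp add: charz_def Complex.DeMoivre mult.assoc mult.left_commute) (simp add: mult_ac)?

lemma charz_period:
  assumes "m > 0" shows "charz m (a * int m) = 1"
proof -
  have "2 * pi * real_of_int (a * int m) / real m = 2 * pi * real_of_int a"
    using assms by simp
  then show ?thesis
    unfolding charz_def by (simp only: cis_multiple_2pi Ints_of_int)
qed

lemma charz_cong:
  assumes "m > 0" "a mod int m = b mod int m"
  shows "charz m a = charz m b"
proof -
  obtain k where "a = b + k * int m"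
    using assms(2) by (metis mod_eqE mult.commute)
  then show ?thesis using assms(1) by (simp add: charz_add charz_period)
qed

lemma charz_eq_1_imp_dvd:
  assumes "m > 0" "charz m a = 1" shows "int m dvd a"
proof -
  have "cos (2 * pi * real_of_int a / real m) = 1"
    using assms(2) by (simp add: charz_def complex_eq_iff)
  then obtain k :: int where k: "2 * pi * real_of_int a / real m = of_int k * 2 * pi"
    by (auto simp: cos_one_2pi_int)
  then have "real_of_int a = of_int k * real m" using assms(1) by (simp add: field_simps)
  then have "a = k * int m" by (metis of_int_eq_iff of_int_mult of_int_of_nat_eq)
  then show ?thesis by simp
qed

text \<open>Frequencies are represented by the residues nearest to 0, so that quadrants and the
  absence of wrap-around become conditions on sign and size.\<close>

definition balanced :: "nat \<Rightarrow> int set" where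
  "balanced m = {a. - int m \<le> 2 * a \<and> 2 * a < int m}"

lemma balanced_alt: "balanced m = (\<lambda>j. int j - int (m div 2)) ` {..<m}"
proof -
  have "a \<in> (\<lambda>j. int j - int (m div 2)) ` {..<m}" if "a \<in> balanced m" for a
    using that by (intro image_eqI[of _ _ "nat (a + int (m div 2))"]) (auto simp: balanced_def)
  then show ?thesis by (auto simp: balanced_def)
qed

lemma finite_balanced [simp]: "finite (balanced m)"
  by (simp add: balanced_alt)

text \<open>Orthogonality of characters: up to a unimodular factor this is a geometric sum whose
  ratio \<open>charz m d\<close> is an \<open>m\<close>-th root of unity.\<close>

lemma sum_charz:
  assumes "m > 0"
  shows "(\<Sum>a\<in>balanced m. charz m (a * d)) = (if int m dvd d then of_nat m else 0)"
proof -
  define h where "h = m div 2"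
  have inj: "inj_on (\<lambda>j. int j - int h) {..<m}" by (auto simp: inj_on_def)
  have "(\<Sum>a\<in>balanced m. charz m (a * d)) = (\<Sum>j<m. charz m ((int j - int h) * d))"
    unfolding balanced_alt h_def[symmetric] by (simp add: sum.reindex[OF inj])
  also have "\<dots> = charz m (- int h * d) * (\<Sum>j<m. charz m d ^ j)"
    unfolding sum_distrib_left charz_power
    by (intro sum.cong refl) (simp add: charz_add[symmetric] algebra_simps)
  also have "\<dots> = (if int m dvd d then of_nat m else 0)"
  proof (cases "int m dvd d")
    case True
    then obtain k where k: "d = k * int m" by (metis dvdE mult.commute)
    have "charz m d = 1" "charz m (- int h * d) = 1"
      using charz_period[OF assms, of k] charz_period[OF assms, of "- int h * k"]
      by (auto simp: k mult.assoc)
    then show ?thesis using True by simp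
  next
    case False
    have "charz m d ^ m = 1" using assms by (simp add: charz_power charz_period)
    moreover have "charz m d \<noteq> 1" using False charz_eq_1_imp_dvd[OF assms] by blast
    ultimately show ?thesis using False by (simp add: geometric_sum)
  qed
  finally show ?thesis .
qed

text \<open>Expanding the squared norm gives a double sum over \<open>x\<close> and
  \<open>y\<close>; summing over the frequencies first leaves only the diagonal.\<close>

lemma parseval:
  fixes g :: "nat \<Rightarrow> complex"
  assumes "m > 0"
  shows "(\<Sum>a\<in>balanced m. (norm (\<Sum>x<m. g x * charz m (a * int x)))\<^sup>2)
       = real m * (\<Sum>x<m. (norm (g x))\<^sup>2)"
proof -
  have dvd: "int m dvd int x - int y \<longleftrightarrow> x = y" if "x < m" "y < m" for x y
    using that by (metis diff_self dvd_0_right mod_eq_dvd_iff mod_less of_nat_eq_iff zmod_int)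
  have "complex_of_real (\<Sum>a\<in>balanced m. (norm (\<Sum>x<m. g x * charz m (a * int x)))\<^sup>2)
    = (\<Sum>a\<in>balanced m. \<Sum>x<m. \<Sum>y<m. g x * cnj (g y) * charz m (a * (int x - int y)))"
    by (simp add: complex_norm_square sum_product cnj_charz right_diff_distrib
        charz_add[symmetric, of m "_ * _" "- (_ * _)", simplified] mult_ac
        flip: of_real_power)
  also have "\<dots> = (\<Sum>x<m. \<Sum>y<m. \<Sum>a\<in>balanced m. g x * cnj (g y) * charz m (a * (int x - int y)))"
    by (subst sum.swap) (intro sum.cong refl sum.swap)
  also have "\<dots> = (\<Sum>x<m. \<Sum>y<m. g x * cnj (g y) * (if int m dvd int x - int y then of_nat m else 0))"
    by (simp add: sum_distrib_left[symmetric] sum_charz[OF assms])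
  also have "\<dots> = (\<Sum>x<m. \<Sum>y<m. if y = x then g x * cnj (g y) * of_nat m else 0)"
    by (intro sum.cong refl) (use dvd in auto)
  also have "\<dots> = complex_of_real (real m * (\<Sum>x<m. (norm (g x))\<^sup>2))"
    by (simp add: complex_norm_square sum_distrib_left mult_ac flip: of_real_power)
  finally show ?thesis using of_real_eq_iff by blast
qed

text \<open>Defined at all integer pairs, so that sheared frequencies such as \<open>b - a\<close>
  need no reduction.\<close>

definition dft :: "nat \<Rightarrow> (nat \<Rightarrow> nat \<Rightarrow> real) \<Rightarrow> int \<Rightarrow> int \<Rightarrow> complex" where
  "dft m f a b = (\<Sum>x<m. \<Sum>y<m. of_real (f x y) * charz m (a * int x + b * int y))"

lemma parseval_dft:
  assumes "m > 0"
  shows "(\<Sum>(a,b)\<in>balanced m \<times> balanced m. (norm (dft m f a b))\<^sup>2)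
    = (real m)\<^sup>2 * (\<Sum>x<m. \<Sum>y<m. (f x y)\<^sup>2)"
proof -
  have dft: "dft m f a b = (\<Sum>x<m. (\<Sum>y<m. of_real (f x y) * charz m (b * int y)) * charz m (a * int x))" for a b
    unfolding dft_def sum_distrib_right by (intro sum.cong refl) (simp add: charz_add)
  have "(\<Sum>(a,b)\<in>balanced m \<times> balanced m. (norm (dft m f a b))\<^sup>2)
    = (\<Sum>b\<in>balanced m. \<Sum>a\<in>balanced m. (norm (dft m f a b))\<^sup>2)"
    by (subst sum.swap) (simp add: sum.cartesian_product)
  also have "\<dots> = (\<Sum>b\<in>balanced m. real m * (\<Sum>x<m. (norm (\<Sum>y<m. of_real (f x y) * charz m (b * int y)))\<^sup>2))"
    unfolding dft parseval[OF assms] ..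
  also have "\<dots> = real m * (\<Sum>x<m. \<Sum>b\<in>balanced m. (norm (\<Sum>y<m. complex_of_real (f x y) * charz m (b * int y)))\<^sup>2)"
    unfolding sum_distrib_left[symmetric] by (subst sum.swap) simp
  also have "\<dots> = (real m)\<^sup>2 * (\<Sum>x<m. \<Sum>y<m. (f x y)\<^sup>2)"
    unfolding parseval[OF assms] by (simp add: sum_distrib_left power2_eq_square mult.assoc)
  finally show ?thesis .
qed

lemma dft_diff: "dft m (\<lambda>x y. f x y - g x y) a b = dft m f a b - dft m g a b"
  by (simp add: dft_def sum_subtractf[symmetric] algebra_simps)

section \<open>Torus generators on the Fourier side\<close>

lemma bij_betw_shift_mod:
  assumes "m > 0"
  shows "bij_betw (\<lambda>x. (x + c) mod m) {..<m} {..<(m::nat)}"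
proof -
  have inj: "inj_on (\<lambda>x. (x + c) mod m) {..<m}"
  proof (rule inj_onI)
    fix x y assume xy: "x \<in> {..<m}" "y \<in> {..<m}" "(x + c) mod m = (y + c) mod m"
    then have "[x = y] (mod m)" by (simp add: cong_def[symmetric] cong_add_rcancel_nat)
    then show "x = y" using xy by (simp add: cong_def)
  qed
  moreover have "(\<lambda>x. (x + c) mod m) ` {..<m} = {..<m}"
    using assms by (intro endo_inj_surj inj) auto
  ultimately show ?thesis by (simp add: bij_betw_def)
qed

lemma charz_shift:
  assumes "m > 0"
  shows "charz m (a * int ((x + c) mod m)) = charz m (a * int x + a * int c)"
  by (rule charz_cong[OF assms]) (simp add: zmod_int mod_mult_right_eq flip: distrib_left)

text \<open>Substituting \<open>x + y\<close> for \<open>x\<close> turns the phase into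
  \<open>a * x + (b - a) * y\<close>: composition with a shear acts on frequencies by the inverse
  transpose.\<close>

lemma dft_shear1:
  assumes "m > 0"
  shows "dft m (\<lambda>x y. f ((x + y) mod m) y) a b = dft m f a (b - a)"
proof -
  have "(\<Sum>x<m. of_real (f ((x + y) mod m) y) * charz m (a * int x + b * int y))
      = (\<Sum>x<m. of_real (f x y) * charz m (a * int x + (b - a) * int y))" for y
  proof -
    have "(\<Sum>x<m. of_real (f x y) * charz m (a * int x + (b - a) * int y))
      = (\<Sum>x<m. of_real (f ((x + y) mod m) y) * charz m (a * int ((x + y) mod m) + (b - a) * int y))"
      using sum.reindex_bij_betw[OF bij_betw_shift_mod[OF assms, of y],
          of "\<lambda>x. of_real (f x y) * charz m (a * int x + (b - a) * int y)"] by simp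
    also have "\<dots> = (\<Sum>x<m. of_real (f ((x + y) mod m) y) * charz m (a * int x + b * int y))"
    proof (intro sum.cong refl)
      fix x
      have "charz m (a * int ((x + y) mod m) + (b - a) * int y)
          = charz m (a * int x + a * int y + (b - a) * int y)"
        by (simp only: charz_add charz_shift[OF assms])
      also have "a * int x + a * int y + (b - a) * int y = a * int x + b * int y"
        by (simp add: algebra_simps)
      finally show "of_real (f ((x + y) mod m) y) * charz m (a * int ((x + y) mod m) + (b - a) * int y)
        = of_real (f ((x + y) mod m) y) * charz m (a * int x + b * int y)"
        by simp
    qed
    finally show ?thesis by simp
  qed
  then show ?thesis unfolding dft_def by (subst (1 2) sum.swap) simp
qed

lemma dft_transpose: "dft m (\<lambda>x y. f y x) a b = dft m f b a"
  unfolding dft_def by (subst sum.swap) (simp add: add.commute)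

lemma dft_shear2:
  assumes "m > 0"
  shows "dft m (\<lambda>x y. f x ((x + y) mod m)) a b = dft m f (a - b) b"
  using dft_shear1[OF assms, of "\<lambda>x y. f y x" b a]
  by (simp add: dft_transpose[of m f] dft_transpose[of m "\<lambda>x y. f x ((x + y) mod m)" b a, symmetric] add.commute)

lemma dft_trans1:
  assumes "m > 0"
  shows "dft m (\<lambda>x y. f ((x + 1) mod m) y) a b = charz m (- a) * dft m f a b"
proof -
  have "(\<Sum>x<m. of_real (f ((x + 1) mod m) y) * charz m (a * int x + b * int y))
      = (\<Sum>x<m. charz m (- a) * (of_real (f x y) * charz m (a * int x + b * int y)))" for y
  proof -
    have "(\<Sum>x<m. charz m (- a) * (of_real (f x y) * charz m (a * int x + b * int y)))
      = (\<Sum>x<m. charz m (- a) * (of_real (f ((x + 1) mod m) y) * charz m (a * int ((x + 1) mod m) + b * int y)))"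
      using sum.reindex_bij_betw[OF bij_betw_shift_mod[OF assms, of 1],
          of "\<lambda>x. charz m (- a) * (of_real (f x y) * charz m (a * int x + b * int y))"] by simp
    also have "\<dots> = (\<Sum>x<m. of_real (f ((x + 1) mod m) y) * charz m (a * int x + b * int y))"
    proof (intro sum.cong refl)
      fix x
      have "charz m (- a) * charz m (a * int ((x + 1) mod m) + b * int y)
          = charz m (- a + (a * int x + a * int 1) + b * int y)"
        by (simp only: charz_add charz_shift[OF assms] mult.assoc)
      then show "charz m (- a) * (of_real (f ((x + 1) mod m) y) * charz m (a * int ((x + 1) mod m) + b * int y))
        = of_real (f ((x + 1) mod m) y) * charz m (a * int x + b * int y)"
        by (simp add: mult.left_commute)
    qed
    finally show ?thesis by simp
  qed
  then show ?thesis unfolding dft_def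
    by (subst (1 2) sum.swap) (simp add: sum_distrib_left)
qed

lemma dft_trans2:
  assumes "m > 0"
  shows "dft m (\<lambda>x y. f x ((y + 1) mod m)) a b = charz m (- b) * dft m f a b"
  using dft_trans1[OF assms, of "\<lambda>x y. f y x" b a]
    dft_transpose[of m f b a] dft_transpose[of m "\<lambda>x y. f x ((y + 1) mod m)" b a]
  by simp

section \<open>Almost invariance of the Fourier mass\<close>

text \<open>Difference of squares, then a weighted inequality of the means. The weight makes the
  error a sixteenth of each square: the four errors in \<open>torus_poincare\<close> then total half
  of the mass and can be absorbed.\<close>

lemma norm_square_diff_le:
  fixes z w :: complex
  shows "\<bar>(norm z)\<^sup>2 - (norm w)\<^sup>2\<bar> \<le> 8 * (norm (z - w))\<^sup>2 + ((norm z)\<^sup>2 + (norm w)\<^sup>2) / 16"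
proof -
  define s where "s = norm z + norm w"
  have "\<bar>(norm z)\<^sup>2 - (norm w)\<^sup>2\<bar> = \<bar>norm z - norm w\<bar> * s"
    by (simp add: s_def abs_mult square_diff_square_factored power2_eq_square mult.commute)
  also have "\<dots> \<le> norm (z - w) * s"
    by (intro mult_right_mono norm_triangle_ineq3) (simp add: s_def)
  also have "\<dots> \<le> 8 * (norm (z - w))\<^sup>2 + s\<^sup>2 / 32"
    using zero_le_power2[of "16 * norm (z - w) - s"] by (simp add: power2_eq_square algebra_simps)
  also have "s\<^sup>2 \<le> 2 * ((norm z)\<^sup>2 + (norm w)\<^sup>2)"
    using zero_le_power2[of "norm z - norm w"] by (simp add: s_def power2_eq_square algebra_simps)
  finally show ?thesis by (simp add: field_simps)
qed

text \<open>The angle is between a quarter and a half turn in absolute value, so its cosine is at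
  most 0; the squared chord is 2 minus twice the cosine.\<close>

lemma charz_minus_1_ge:
  assumes "m > 0" "a \<in> balanced m" "int m \<le> 4 * \<bar>a\<bar>"
  shows "2 \<le> (norm (charz m (- a) - 1))\<^sup>2"
proof -
  define t where "t = 2 * pi * \<bar>real_of_int a\<bar> / real m"
  have "real m \<le> real_of_int (4 * \<bar>a\<bar>)" using assms(3) by linarith
  then have t1: "pi / 2 \<le> t" using assms(1) by (simp add: t_def field_simps)
  have "\<bar>2 * a\<bar> \<le> int m" using assms(2) by (auto simp: balanced_def)
  then have "real_of_int \<bar>2 * a\<bar> \<le> real m" by linarith
  then have t2: "t \<le> pi" using assms(1) by (simp add: t_def field_simps)
  have "cos t \<le> 0"
    using cos_monotone_0_pi_le[of "pi / 2" t] t1 t2 by simp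
  moreover have "cos t = cos (2 * pi * real_of_int (- a) / real m)"
    by (cases "a \<ge> 0") (simp_all add: t_def)
  ultimately have "Re (charz m (- a)) \<le> 0" by (simp add: charz_def)
  moreover have "(norm (charz m (- a) - 1))\<^sup>2 = 2 - 2 * Re (charz m (- a))"
  proof -
    have "(Re (charz m (- a)))\<^sup>2 + (Im (charz m (- a)))\<^sup>2 = 1"
      using norm_charz[of m "- a"] by (simp add: cmod_def)
    then show ?thesis unfolding cmod_power2 by (simp add: power2_eq_square algebra_simps)
  qed
  ultimately show ?thesis by simp
qed

definition shift_energy :: "nat \<Rightarrow> (nat \<Rightarrow> nat \<Rightarrow> real) \<Rightarrow> (nat \<Rightarrow> nat \<Rightarrow> real) \<Rightarrow> real" where
  "shift_energy m f g = (\<Sum>x<m. \<Sum>y<m. (g x y - f x y)\<^sup>2)"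

text \<open>Meant for translations, which multiply the transform by \<open>c\<close>. Where
  \<open>c\<close> is far from 1, the transform of \<open>g - f\<close> dominates that of
  \<open>f\<close>, and Parseval bounds its mass by the energy.\<close>

lemma dft_tail_bound:
  assumes "m > 0" and fin: "finite X" and X: "X \<subseteq> balanced m \<times> balanced m"
    and c: "\<And>a b. (a, b) \<in> X \<Longrightarrow> 2 \<le> (norm (c a b - 1))\<^sup>2"
    and g: "\<And>a b. dft m g a b = c a b * dft m f a b"
  shows "(\<Sum>(a,b)\<in>X. (norm (dft m f a b))\<^sup>2) \<le> (real m)\<^sup>2 * shift_energy m f g / 2"
proof -
  have "(\<Sum>(a,b)\<in>X. (norm (dft m f a b))\<^sup>2)
     \<le> (\<Sum>(a,b)\<in>X. (norm (dft m (\<lambda>x y. g x y - f x y) a b))\<^sup>2 / 2)"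
  proof (rule sum_mono, clarify)
    fix a b assume "(a, b) \<in> X"
    have "dft m (\<lambda>x y. g x y - f x y) a b = (c a b - 1) * dft m f a b"
      by (simp add: dft_diff g algebra_simps)
    then show "(norm (dft m f a b))\<^sup>2 \<le> (norm (dft m (\<lambda>x y. g x y - f x y) a b))\<^sup>2 / 2"
      using mult_right_mono[OF c[OF \<open>(a, b) \<in> X\<close>], of "(norm (dft m f a b))\<^sup>2"]
      by (simp add: norm_mult power_mult_distrib)
  qed
  also have "\<dots> \<le> (\<Sum>(a,b)\<in>balanced m \<times> balanced m. (norm (dft m (\<lambda>x y. g x y - f x y) a b))\<^sup>2 / 2)"
    using X by (intro sum_mono2) auto
  also have "\<dots> = (real m)\<^sup>2 * shift_energy m f g / 2"
    using parseval_dft[OF assms(1), of "\<lambda>x y. g x y - f x y"]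
    by (simp add: shift_energy_def sum_divide_distrib[symmetric] case_prod_unfold)
  finally show ?thesis .
qed

text \<open>Meant for \<open>g\<close> equal to \<open>f\<close> after a shear, with
  \<open>U\<close> the induced map of frequencies. The mass of \<open>f\<close> on the image of
  \<open>B\<close> is the mass of \<open>g\<close> on \<open>B\<close>; the two functions are
  compared frequency by frequency and the errors summed by Parseval.\<close>

lemma dft_mass_change:
  assumes "m > 0" and B: "B \<subseteq> balanced m \<times> balanced m"
    and g: "\<And>a b. dft m g a b = dft m f (fst (U (a, b))) (snd (U (a, b)))"
    and inj: "inj_on U B" and norm_g: "(\<Sum>x<m. \<Sum>y<m. (g x y)\<^sup>2) = (\<Sum>x<m. \<Sum>y<m. (f x y)\<^sup>2)"
  shows "\<bar>(\<Sum>(a,b)\<in>U ` B. (norm (dft m f a b))\<^sup>2) - (\<Sum>(a,b)\<in>B. (norm (dft m f a b))\<^sup>2)\<bar>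
    \<le> (real m)\<^sup>2 * (8 * shift_energy m f g + (\<Sum>x<m. \<Sum>y<m. (f x y)\<^sup>2) / 8)"
proof -
  let ?I = "balanced m \<times> balanced m"
  have "\<bar>(\<Sum>(a,b)\<in>U ` B. (norm (dft m f a b))\<^sup>2) - (\<Sum>(a,b)\<in>B. (norm (dft m f a b))\<^sup>2)\<bar>
    = \<bar>\<Sum>(a,b)\<in>B. (norm (dft m g a b))\<^sup>2 - (norm (dft m f a b))\<^sup>2\<bar>"
    by (simp add: sum.reindex[OF inj] g case_prod_unfold sum_subtractf)
  also have "\<dots> \<le> (\<Sum>(a,b)\<in>B. \<bar>(norm (dft m g a b))\<^sup>2 - (norm (dft m f a b))\<^sup>2\<bar>)"
    unfolding case_prod_unfold by (rule sum_abs)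
  also have "\<dots> \<le> (\<Sum>(a,b)\<in>?I. \<bar>(norm (dft m g a b))\<^sup>2 - (norm (dft m f a b))\<^sup>2\<bar>)"
    using B by (intro sum_mono2) auto
  also have "\<dots> \<le> (\<Sum>(a,b)\<in>?I. 8 * (norm (dft m (\<lambda>x y. g x y - f x y) a b))\<^sup>2
      + ((norm (dft m g a b))\<^sup>2 + (norm (dft m f a b))\<^sup>2) / 16)"
    unfolding dft_diff by (intro sum_mono) (auto intro: norm_square_diff_le)
  also have "\<dots> = 8 * (\<Sum>(a,b)\<in>?I. (norm (dft m (\<lambda>x y. g x y - f x y) a b))\<^sup>2)
      + ((\<Sum>(a,b)\<in>?I. (norm (dft m g a b))\<^sup>2) + (\<Sum>(a,b)\<in>?I. (norm (dft m f a b))\<^sup>2)) / 16"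
    by (simp add: sum.distrib sum_distrib_left sum_divide_distrib case_prod_unfold add_divide_distrib)
  also have "\<dots> = (real m)\<^sup>2 * (8 * shift_energy m f g + (\<Sum>x<m. \<Sum>y<m. (f x y)\<^sup>2) / 8)"
    unfolding parseval_dft[OF assms(1)] shift_energy_def norm_g by (simp add: algebra_simps)
  finally show ?thesis .
qed

lemma sum_shear1:
  fixes m :: nat
  assumes "m > 0"
  shows "(\<Sum>x<m. \<Sum>y<m. h ((x + y) mod m) y) = (\<Sum>x<m. \<Sum>y<m. (h x y :: real))"
proof -
  have "(\<Sum>x<m. h ((x + y) mod m) y) = (\<Sum>x<m. h x y)" for y
    using sum.reindex_bij_betw[OF bij_betw_shift_mod[OF assms, of y], of "\<lambda>x. h x y"] by simp
  then show ?thesis by (subst (1 2) sum.swap) simp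
qed

lemma sum_shear2:
  fixes m :: nat
  assumes "m > 0"
  shows "(\<Sum>x<m. \<Sum>y<m. h x ((x + y) mod m)) = (\<Sum>x<m. \<Sum>y<m. (h x y :: real))"
proof (rule sum.cong[OF refl])
  fix x
  show "(\<Sum>y<m. h x ((x + y) mod m)) = (\<Sum>y<m. h x y)"
    using sum.reindex_bij_betw[OF bij_betw_shift_mod[OF assms, of x], of "h x"]
    by (simp add: add.commute)
qed

text \<open>
  The two shears of the frequency lattice and their inverses map the first and third
  quadrants (respectively the second and fourth) into two disjoint parts of themselves, so a
  measure that is almost invariant under them gives little mass to either pair of quadrants.
  Small frequencies have no wrap-around, and large ones are controlled by the translations.
\<close>

theorem torus_poincare:
  fixes f :: "nat \<Rightarrow> nat \<Rightarrow> real"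
  assumes m: "m > 0" and mean: "(\<Sum>x<m. \<Sum>y<m. f x y) = 0"
  shows "(\<Sum>x<m. \<Sum>y<m. (f x y)\<^sup>2) \<le> 32 *
    (shift_energy m f (\<lambda>x y. f ((x + y) mod m) y) + shift_energy m f (\<lambda>x y. f x ((x + y) mod m))
     + shift_energy m f (\<lambda>x y. f ((x + 1) mod m) y) + shift_energy m f (\<lambda>x y. f x ((y + 1) mod m)))"
proof -
  define ES where "ES = shift_energy m f (\<lambda>x y. f ((x + y) mod m) y)"
  define ET where "ET = shift_energy m f (\<lambda>x y. f x ((x + y) mod m))"
  define E1 where "E1 = shift_energy m f (\<lambda>x y. f ((x + 1) mod m) y)"
  define E2 where "E2 = shift_energy m f (\<lambda>x y. f x ((y + 1) mod m))"
  define F where "F = (\<Sum>x<m. \<Sum>y<m. (f x y)\<^sup>2)"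
  define M where "M = (real m)\<^sup>2"
  define I where "I = balanced m \<times> balanced m"
  define \<nu> where "\<nu> X = (\<Sum>(a,b)\<in>X. (norm (dft m f a b))\<^sup>2)" for X
  \<comment> \<open>The horizontal axis is attached to \<open>Q13\<close> and the vertical one to
    \<open>Q24\<close>, so that these two sets and the origin partition the lattice.\<close>
  define Q13 :: "(int \<times> int) set" where "Q13 = {(a, b). a > 0 \<and> b \<ge> 0 \<or> a < 0 \<and> b \<le> 0}"
  define Q24 :: "(int \<times> int) set" where "Q24 = {(a, b). a \<le> 0 \<and> b > 0 \<or> a \<ge> 0 \<and> b < 0}"
  \<comment> \<open>Coordinates below a quarter of \<open>m\<close> have sums and differences that
    stay in \<open>balanced m\<close>.\<close>
  define box :: "(int \<times> int) set" where "box = {(a, b). 4 * \<bar>a\<bar> < int m \<and> 4 * \<bar>b\<bar> < int m}"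
  \<comment> \<open>\<open>U\<close> and \<open>W\<close> are the frequency maps of
    \<open>dft_shear1\<close> and \<open>dft_shear2\<close>; \<open>U'\<close> and \<open>W'\<close>
    are their inverses.\<close>
  define U :: "int \<times> int \<Rightarrow> int \<times> int" where "U = (\<lambda>(a, b). (a, b - a))"
  define W :: "int \<times> int \<Rightarrow> int \<times> int" where "W = (\<lambda>(a, b). (a - b, b))"
  define U' :: "int \<times> int \<Rightarrow> int \<times> int" where "U' = (\<lambda>(a, b). (a, a + b))"
  define W' :: "int \<times> int \<Rightarrow> int \<times> int" where "W' = (\<lambda>(a, b). (a + b, b))"
  have fin: "finite I" by (simp add: I_def)
  have mono: "\<nu> X \<le> \<nu> Y" if "X \<subseteq> Y" "finite Y" for X Y
    unfolding \<nu>_def using that by (intro sum_mono2) auto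
  have disj: "\<nu> (X \<union> Y) = \<nu> X + \<nu> Y" if "X \<inter> Y = {}" "finite X" "finite Y" for X Y
    unfolding \<nu>_def using that by (intro sum.union_disjoint) auto
  have subadd: "\<nu> (X \<union> Y) \<le> \<nu> X + \<nu> Y" if "finite X" "finite Y" for X Y
    using disj[of X "Y - X"] mono[of "Y - X" Y] that by simp
  have total: "\<nu> I = M * F"
    unfolding \<nu>_def I_def M_def F_def by (rule parseval_dft[OF m])
  have box_I: "box \<subseteq> I" by (auto simp: box_def I_def balanced_def)
  have "\<nu> (I - box) \<le> \<nu> {(a, b) \<in> I. int m \<le> 4 * \<bar>a\<bar>} + \<nu> {(a, b) \<in> I. int m \<le> 4 * \<bar>b\<bar>}"
  proof -
    have "\<nu> (I - box) \<le> \<nu> ({(a, b) \<in> I. int m \<le> 4 * \<bar>a\<bar>} \<union> {(a, b) \<in> I. int m \<le> 4 * \<bar>b\<bar>})"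
      by (intro mono) (auto simp: box_def intro: finite_subset[OF _ fin])
    also have "\<dots> \<le> \<nu> {(a, b) \<in> I. int m \<le> 4 * \<bar>a\<bar>} + \<nu> {(a, b) \<in> I. int m \<le> 4 * \<bar>b\<bar>}"
      by (intro subadd) (auto intro: finite_subset[OF _ fin])
    finally show ?thesis .
  qed
  also have "\<nu> {(a, b) \<in> I. int m \<le> 4 * \<bar>a\<bar>} \<le> M * E1 / 2"
    unfolding \<nu>_def M_def E1_def
    by (rule dft_tail_bound[OF m, where c = "\<lambda>a b. charz m (- a)"])
      (use m in \<open>auto simp: I_def intro!: charz_minus_1_ge dft_trans1 finite_subset[OF _ fin[unfolded I_def]] simp del: One_nat_def\<close>)
  also have "\<nu> {(a, b) \<in> I. int m \<le> 4 * \<bar>b\<bar>} \<le> M * E2 / 2"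
    unfolding \<nu>_def M_def E2_def
    by (rule dft_tail_bound[OF m, where c = "\<lambda>a b. charz m (- b)"])
      (use m in \<open>auto simp: I_def intro!: charz_minus_1_ge dft_trans2 finite_subset[OF _ fin[unfolded I_def]] simp del: One_nat_def\<close>)
  finally have tail: "\<nu> (I - box) \<le> M * E1 / 2 + M * E2 / 2" by simp
  have U: "\<bar>\<nu> (U ` B) - \<nu> B\<bar> \<le> M * (8 * ES + F / 8)" if "B \<subseteq> I" for B
    unfolding \<nu>_def M_def ES_def F_def
    by (rule dft_mass_change[OF m])
      (use that m in \<open>auto simp: I_def U_def inj_on_def dft_shear1 sum_shear1[where h = "\<lambda>x y. (f x y)\<^sup>2"]\<close>)
  have W: "\<bar>\<nu> (W ` B) - \<nu> B\<bar> \<le> M * (8 * ET + F / 8)" if "B \<subseteq> I" for B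
    unfolding \<nu>_def M_def ET_def F_def
    by (rule dft_mass_change[OF m])
      (use that m in \<open>auto simp: I_def W_def inj_on_def dft_shear2 sum_shear2[where h = "\<lambda>x y. (f x y)\<^sup>2"]\<close>)
  have UU': "U ` U' ` A = A" and WW': "W ` W' ` A = A" for A
    by (force simp: image_image U_def U'_def W_def W'_def)+
  have "2 * \<nu> (Q13 \<inter> box) \<le> \<nu> (Q13 \<inter> I) + M * (8 * ES + F / 8) + M * (8 * ET + F / 8)"
  proof -
    let ?A = "Q13 \<inter> box"
    have U': "U' ` ?A \<subseteq> Q13 \<inter> I" and W': "W' ` ?A \<subseteq> Q13 \<inter> I"
      by (auto simp: U'_def W'_def Q13_def box_def I_def balanced_def)
    \<comment> \<open>The diagonals separate the images: after \<open>U'\<close> the second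
      coordinate is at least as large as the first in absolute value, after \<open>W'\<close> it is
      strictly smaller.\<close>
    have "U' ` ?A \<inter> W' ` ?A = {}" by (auto simp: U'_def W'_def Q13_def)
    then have "\<nu> (U' ` ?A) + \<nu> (W' ` ?A) = \<nu> (U' ` ?A \<union> W' ` ?A)"
      using U' W' fin by (intro disj[symmetric]) (auto intro: finite_subset)
    also have "\<dots> \<le> \<nu> (Q13 \<inter> I)" using U' W' fin by (intro mono) auto
    finally show ?thesis
      using U[of "U' ` ?A"] W[of "W' ` ?A"] U' W' unfolding UU' WW' by auto
  qed
  moreover have "2 * \<nu> (Q24 \<inter> box) \<le> \<nu> (Q24 \<inter> I) + M * (8 * ES + F / 8) + M * (8 * ET + F / 8)"
  proof -
    let ?A = "Q24 \<inter> box"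
    \<comment> \<open>Here the coordinates have opposite signs, so \<open>U\<close> and
      \<open>W\<close> themselves enlarge a coordinate and no inverses are taken.\<close>
    have U': "U ` ?A \<subseteq> Q24 \<inter> I" and W': "W ` ?A \<subseteq> Q24 \<inter> I"
      by (auto simp: U_def W_def Q24_def box_def I_def balanced_def)
    have "U ` ?A \<inter> W ` ?A = {}" by (auto simp: U_def W_def Q24_def)
    then have "\<nu> (U ` ?A) + \<nu> (W ` ?A) = \<nu> (U ` ?A \<union> W ` ?A)"
      using U' W' fin by (intro disj[symmetric]) (auto intro: finite_subset)
    also have "\<dots> \<le> \<nu> (Q24 \<inter> I)" using U' W' fin by (intro mono) auto
    finally have "\<nu> (U ` ?A) + \<nu> (W ` ?A) \<le> \<nu> (Q24 \<inter> I)" .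
    moreover have "?A \<subseteq> I" using box_I by blast
    ultimately show ?thesis using U[of ?A] W[of ?A] by argo
  qed
  moreover have "\<nu> (Q13 \<inter> box) + \<nu> (Q24 \<inter> box) + \<nu> (I - box) = M * F"
  proof -
    \<comment> \<open>The mean enters only here: it removes the origin, the one frequency fixed by
      both shears.\<close>
    have zero: "dft m f 0 0 = 0"
      using mean by (simp add: dft_def flip: of_real_sum)
    have I_eq: "I = (Q13 \<inter> box) \<union> ((Q24 \<inter> box) \<union> ((I - box) \<union> {(0, 0)}))"
      using box_I m by (auto simp: Q13_def Q24_def I_def balanced_def)
    have "M * F = \<nu> (Q13 \<inter> box) + (\<nu> (Q24 \<inter> box) + (\<nu> (I - box) + \<nu> {(0, 0)}))"
      unfolding total[symmetric]
      by (subst I_eq, subst disj; (subst disj)?; (subst disj)?)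
        (use box_I fin m in \<open>auto simp: Q13_def Q24_def box_def intro: finite_subset\<close>)
    then show ?thesis using zero by (simp add: \<nu>_def)
  qed
  moreover have "\<nu> (Q13 \<inter> I) + \<nu> (Q24 \<inter> I) \<le> M * F"
  proof -
    have "\<nu> (Q13 \<inter> I) + \<nu> (Q24 \<inter> I) = \<nu> ((Q13 \<inter> I) \<union> (Q24 \<inter> I))"
      using fin by (intro disj[symmetric]) (auto simp: Q13_def Q24_def)
    also have "\<dots> \<le> \<nu> I" using fin by (intro mono) auto
    finally show ?thesis using total by simp
  qed
  \<comment> \<open>Twice the mass in the box is at most the full mass plus errors, and the box
    misses only the tail. The four errors \<open>F / 8\<close> still leave half of \<open>F\<close>
    on the left.\<close>
  ultimately have "2 * (M * F - (M * E1 / 2 + M * E2 / 2)) \<le> M * F + 2 * M * (8 * ES + F / 8) + 2 * M * (8 * ET + F / 8)"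
    using tail by argo
  then have "M * F \<le> M * (2 * E1 + 2 * E2 + 32 * ES + 32 * ET)" by argo
  then have "F \<le> 2 * E1 + 2 * E2 + 32 * ES + 32 * ET" using m by (simp add: M_def)
  moreover have "E1 \<ge> 0" "E2 \<ge> 0" unfolding E1_def E2_def shift_energy_def by (auto intro!: sum_nonneg)
  ultimately have "F \<le> 32 * (ES + ET + E1 + E2)" by argo
  then show ?thesis by (simp add: F_def ES_def ET_def E1_def E2_def)
qed

section \<open>Random walks on cubic graphs given by three perfect matchings\<close>

text \<open>The matchings form a proper 3-edge-colouring, which makes the graph simple and cubic.
  Expansion enters only through \<open>poincare\<close>; \<open>triangle\<close> supplies the odd
  cycle 0, 2, 3.\<close>

locale cubic_graph =
  fixes n :: nat and \<sigma> :: "nat \<Rightarrow> nat \<Rightarrow> nat" and C :: real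
  assumes n_ge_2: "n \<ge> 2"
    and \<sigma>_less: "i < 3 \<Longrightarrow> u < n \<Longrightarrow> \<sigma> i u < n"
    and \<sigma>_invol: "i < 3 \<Longrightarrow> u < n \<Longrightarrow> \<sigma> i (\<sigma> i u) = u"
    and \<sigma>_neq: "i < 3 \<Longrightarrow> u < n \<Longrightarrow> \<sigma> i u \<noteq> u"
    and \<sigma>_inj: "i < 3 \<Longrightarrow> j < 3 \<Longrightarrow> u < n \<Longrightarrow> \<sigma> i u = \<sigma> j u \<Longrightarrow> i = j"
    and triangle: "\<sigma> 0 2 = 3" "\<sigma> 1 0 = 2" "\<sigma> 2 3 = 0" "3 < n"
    and poincare: "(\<Sum>u<n. f u) = 0 \<Longrightarrow>
      (\<Sum>u<n. (f u)\<^sup>2) \<le> C * (\<Sum>u<n. \<Sum>i<3. (f u - f (\<sigma> i u))\<^sup>2)"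
    and C_ge_1: "C \<ge> 1"
begin

section \<open>The graph and its transition operator\<close>

definition G :: "nat pair_pre_digraph" where
  "G = \<lparr>pverts = {..<n}, parcs = {(u, v). u < n \<and> (\<exists>i<3. v = \<sigma> i u)}\<rparr>"

lemma pverts_G [simp]: "pverts G = {..<n}"
  by (simp add: G_def)

lemma parcs_G: "parcs G = {(u, v). u < n \<and> (\<exists>i<3. v = \<sigma> i u)}"
  by (simp add: G_def)

lemma neighbours_G: "u < n \<Longrightarrow> neighbours G u = (\<lambda>i. \<sigma> i u) ` {..<3}"
  by (auto simp: neighbours_def parcs_G)

lemma inj_on_\<sigma>: "u < n \<Longrightarrow> inj_on (\<lambda>i. \<sigma> i u) {..<3}"
  by (auto simp: inj_on_def dest: \<sigma>_inj)

lemma card_neighbours_G: "u < n \<Longrightarrow> card (neighbours G u) = 3"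
  by (simp add: neighbours_G card_image[OF inj_on_\<sigma>])

lemma finite_parcs_G: "finite (parcs G)"
  by (rule finite_subset[of _ "{..<n} \<times> {..<n}"]) (auto simp: parcs_G \<sigma>_less)

lemma regular_graph_G: "regular_graph 3 G"
proof -
  have "pair_graph G"
  proof
    show "symmetric (with_proj G)"
      unfolding symmetric_def
      by (auto simp: parcs_G sym_def intro: \<sigma>_less) (metis \<sigma>_invol)
  qed (use finite_parcs_G in \<open>auto simp: parcs_G \<sigma>_less dest: \<sigma>_neq\<close>)
  then show ?thesis
    using n_ge_2 by (auto simp: regular_graph_def card_neighbours_G lessThan_empty_iff)
qed

lemma sum_\<sigma>:
  assumes "i < 3" shows "(\<Sum>u<n. f (\<sigma> i u)) = (\<Sum>u<n. (f u :: real))"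
  by (rule sum.reindex_bij_witness[of _ "\<sigma> i" "\<sigma> i"]) (use assms \<sigma>_less \<sigma>_invol in auto)

text \<open>The transition operator. The graph being regular, it is symmetric for the counting
  measure, so the same \<open>P\<close> moves functions and probability vectors.\<close>

definition P :: "(nat \<Rightarrow> real) \<Rightarrow> nat \<Rightarrow> real" where
  "P f u = (\<Sum>i<3. f (\<sigma> i u)) / 3"

definition \<delta> :: "nat \<Rightarrow> nat \<Rightarrow> real" where
  "\<delta> x y = of_bool (y = x)"

lemma P_diff: "P (\<lambda>u. f u - g u) = (\<lambda>u. P f u - P g u)"
  by (simp add: P_def fun_eq_iff sum_subtractf diff_divide_distrib)

lemma P_cmult: "P (\<lambda>u. c * f u) = (\<lambda>u. c * P f u)"
  by (simp add: P_def fun_eq_iff sum_distrib_left)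

lemma P_const: "P (\<lambda>u. c) = (\<lambda>u. c)"
  by (simp add: P_def fun_eq_iff)

lemma sum_P: "(\<Sum>u<n. P f u) = (\<Sum>u<n. f u)"
proof -
  have "(\<Sum>u<n. P f u) = (\<Sum>i<3. \<Sum>u<n. f (\<sigma> i u)) / 3"
    unfolding P_def sum_divide_distrib[symmetric] by (subst sum.swap) simp
  also have "\<dots> = (\<Sum>u<n. f u)" by (simp add: sum_\<sigma>)
  finally show ?thesis .
qed

text \<open>Each matching is an involution of the vertex set, so moving it from one factor to the
  other is a change of variable.\<close>

lemma P_selfadjoint: "(\<Sum>u<n. f u * P g u) = (\<Sum>u<n. P f u * g u)"
proof -
  have eq: "(\<Sum>u<n. f u * g (\<sigma> i u)) = (\<Sum>u<n. f (\<sigma> i u) * g u)" if "i < 3" for i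
    using sum_\<sigma>[OF that, of "\<lambda>u. f u * g (\<sigma> i u)"] that by (simp add: \<sigma>_invol)
  have "(\<Sum>u<n. f u * P g u) = (\<Sum>i<3. \<Sum>u<n. f u * g (\<sigma> i u)) / 3"
    by (subst sum.swap) (simp add: P_def sum_distrib_left sum_divide_distrib)
  also have "\<dots> = (\<Sum>i<3. \<Sum>u<n. f (\<sigma> i u) * g u) / 3"
    by (intro arg_cong2[of _ _ _ _ "(/)"] sum.cong refl eq) auto
  also have "\<dots> = (\<Sum>u<n. P f u * g u)"
    by (subst sum.swap) (simp add: P_def sum_distrib_right sum_divide_distrib)
  finally show ?thesis .
qed

lemma energy_eq:
  "(\<Sum>u<n. \<Sum>i<3. (f u - f (\<sigma> i u))\<^sup>2) = 6 * ((\<Sum>u<n. (f u)\<^sup>2) - (\<Sum>u<n. f u * P f u))"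
proof -
  have "(\<Sum>u<n. \<Sum>i<3. (f u - f (\<sigma> i u))\<^sup>2)
    = (\<Sum>u<n. 3 * (f u)\<^sup>2 + (\<Sum>i<3. (f (\<sigma> i u))\<^sup>2) - 6 * (f u * P f u))"
    by (intro sum.cong refl) (simp add: P_def power2_eq_square algebra_simps eval_nat_numeral)
  also have "\<dots> = 3 * (\<Sum>u<n. (f u)\<^sup>2) + (\<Sum>i<3. \<Sum>u<n. (f (\<sigma> i u))\<^sup>2) - 6 * (\<Sum>u<n. f u * P f u)"
    using sum.swap[of "\<lambda>u i. (f (\<sigma> i u))\<^sup>2" "{..<3}" "{..<n}"]
    by (simp add: sum.distrib sum_subtractf sum_distrib_left)
  also have "(\<Sum>i<3. \<Sum>u<n. (f (\<sigma> i u))\<^sup>2) = 3 * (\<Sum>u<n. (f u)\<^sup>2)"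
    by (simp add: sum_\<sigma>[where f = "\<lambda>u. (f u)\<^sup>2"])
  finally show ?thesis by simp
qed

text \<open>Jensen: the square of an average of three values is at most the average of their
  squares, and \<open>P\<close> preserves sums.\<close>

lemma P_contract: "(\<Sum>u<n. (P f u)\<^sup>2) \<le> (\<Sum>u<n. (f u)\<^sup>2)"
proof -
  have "(P f u)\<^sup>2 \<le> P (\<lambda>v. (f v)\<^sup>2) u" for u
  proof -
    have "0 \<le> (f (\<sigma> 0 u) - f (\<sigma> 1 u))\<^sup>2 + (f (\<sigma> 0 u) - f (\<sigma> 2 u))\<^sup>2 + (f (\<sigma> 1 u) - f (\<sigma> 2 u))\<^sup>2"
      by simp
    then show ?thesis
      by (simp add: P_def power2_eq_square algebra_simps eval_nat_numeral)
  qed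
  then have "(\<Sum>u<n. (P f u)\<^sup>2) \<le> (\<Sum>u<n. P (\<lambda>v. (f v)\<^sup>2) u)" by (intro sum_mono)
  then show ?thesis by (simp add: sum_P)
qed

lemma P_nonneg: "(\<And>u. f u \<ge> 0) \<Longrightarrow> P f u \<ge> 0"
  by (simp add: P_def sum_nonneg)

lemma funpow_P_nonneg: "(\<And>u. f u \<ge> 0) \<Longrightarrow> (P ^^ t) f u \<ge> 0"
  by (induction t arbitrary: u) (simp_all add: P_nonneg)

lemma sum_funpow_P: "(\<Sum>u<n. (P ^^ t) f u) = (\<Sum>u<n. f u)"
  by (induction t) (simp_all add: sum_P)

lemma funpow_P_selfadjoint: "(\<Sum>u<n. f u * (P ^^ t) g u) = (\<Sum>u<n. (P ^^ t) f u * g u)"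
proof (induction t arbitrary: f)
  case (Suc t)
  show ?case using Suc[of "P f"] by (simp add: P_selfadjoint funpow_swap1[of P t f])
qed simp

lemma funpow_P_diff: "(P ^^ t) (\<lambda>u. f u - g u) = (\<lambda>u. (P ^^ t) f u - (P ^^ t) g u)"
  by (induction t) (simp_all add: P_diff)

lemma funpow_P_const: "(P ^^ t) (\<lambda>u. c) = (\<lambda>u. c)"
  by (induction t) (simp_all add: P_const)

lemma sum_\<delta>: "x < n \<Longrightarrow> (\<Sum>u<n. \<delta> x u * f u) = f x" "x < n \<Longrightarrow> (\<Sum>u<n. f u * \<delta> x u) = f x"
  "x < n \<Longrightarrow> (\<Sum>u<n. \<delta> x u) = 1"
  by (simp_all add: \<delta>_def)

lemma \<delta>_nonneg: "\<delta> x u \<ge> 0"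
  by (simp add: \<delta>_def)

lemma funpow_P_eq_kernel:
  "x < n \<Longrightarrow> (P ^^ t) f x = (\<Sum>y<n. (P ^^ t) (\<delta> x) y * f y)"
  using funpow_P_selfadjoint[of "\<delta> x" t f] by (simp add: sum_\<delta>)

lemma kernel_sym:
  assumes "x < n" "y < n" shows "(P ^^ t) (\<delta> x) y = (P ^^ t) (\<delta> y) x"
  using funpow_P_selfadjoint[of "\<delta> y" t "\<delta> x"] assms by (simp add: sum_\<delta>)

section \<open>Return probabilities and the lazy walk\<close>

lemma return_prob:
  "x < n \<Longrightarrow> (P ^^ (2 * t)) (\<delta> x) x = (\<Sum>u<n. ((P ^^ t) (\<delta> x) u)\<^sup>2)"
  using funpow_P_selfadjoint[of "\<delta> x" t "(P ^^ t) (\<delta> x)"]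
  by (simp add: sum_\<delta> power2_eq_square mult_2 funpow_add)

text \<open>A return probability at an even time is a squared norm, and \<open>P\<close> does not
  increase norms.\<close>

lemma return_prob_antimono:
  assumes "x < n" "s \<le> t" shows "(P ^^ (2 * t)) (\<delta> x) x \<le> (P ^^ (2 * s)) (\<delta> x) x"
  using assms(2)
proof (induction rule: dec_induct)
  case (step t)
  have "(P ^^ (2 * Suc t)) (\<delta> x) x \<le> (P ^^ (2 * t)) (\<delta> x) x"
    unfolding return_prob[OF assms(1)] using P_contract[of "(P ^^ t) (\<delta> x)"] by simp
  then show ?case using step by simp
qed simp

text \<open>The lazy walk contracts the mean-zero functions without any control on the
  eigenvalues near \<open>-1\<close>.\<close>

definition Q :: "(nat \<Rightarrow> real) \<Rightarrow> nat \<Rightarrow> real" where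
  "Q f u = (f u + P f u) / 2"

lemma sum_Q: "(\<Sum>u<n. Q f u) = (\<Sum>u<n. f u)"
  by (simp add: Q_def sum_divide_distrib[symmetric] sum.distrib sum_P)

lemma sum_funpow_Q: "(\<Sum>u<n. (Q ^^ t) f u) = (\<Sum>u<n. f u)"
  by (induction t) (simp_all add: sum_Q)

lemma Q_selfadjoint: "(\<Sum>u<n. f u * Q g u) = (\<Sum>u<n. Q f u * g u)"
  using P_selfadjoint[of f g]
  by (simp add: Q_def sum_divide_distrib[symmetric] distrib_left distrib_right sum.distrib)

lemma funpow_Q_selfadjoint: "(\<Sum>u<n. f u * (Q ^^ t) g u) = (\<Sum>u<n. (Q ^^ t) f u * g u)"
proof (induction t arbitrary: f)
  case (Suc t)
  show ?case using Suc[of "Q f"] by (simp add: Q_selfadjoint funpow_swap1[of Q t f])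
qed simp

lemma Q_diff: "Q (\<lambda>u. f u - g u) = (\<lambda>u. Q f u - Q g u)"
  by (simp add: Q_def P_diff fun_eq_iff diff_divide_distrib add_divide_distrib)

lemma Q_const: "Q (\<lambda>u. c) = (\<lambda>u. c)"
  by (simp add: Q_def[abs_def] P_const)

lemma funpow_Q_diff: "(Q ^^ t) (\<lambda>u. f u - g u) = (\<lambda>u. (Q ^^ t) f u - (Q ^^ t) g u)"
  by (induction t) (simp_all add: Q_diff)

lemma funpow_Q_const: "(Q ^^ t) (\<lambda>u. c) = (\<lambda>u. c)"
  by (induction t) (simp_all add: Q_const)

text \<open>In the notation of the proof, \<open>D \<le> A\<close> bounds the left side by
  \<open>A - (A - B) / 2\<close>, while Poincare and \<open>energy_eq\<close> give
  \<open>A \<le> 6 * C * (A - B)\<close>.\<close>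

lemma Q_contract:
  assumes "(\<Sum>u<n. f u) = 0"
  shows "(\<Sum>u<n. (Q f u)\<^sup>2) \<le> (1 - 1 / (12 * C)) * (\<Sum>u<n. (f u)\<^sup>2)"
proof -
  define A B D where "A = (\<Sum>u<n. (f u)\<^sup>2)" and "B = (\<Sum>u<n. f u * P f u)" and "D = (\<Sum>u<n. (P f u)\<^sup>2)"
  have "(\<Sum>u<n. (Q f u)\<^sup>2) = (A + 2 * B + D) / 4"
  proof -
    have "(Q f u)\<^sup>2 = ((f u)\<^sup>2 + 2 * (f u * P f u) + (P f u)\<^sup>2) / 4" for u
      by (simp add: Q_def power2_eq_square field_simps)
    then show ?thesis
      unfolding A_def B_def D_def sum_distrib_left by (simp only: sum.distrib sum_divide_distrib[symmetric])
  qed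
  moreover have "D \<le> A" unfolding A_def D_def by (rule P_contract)
  moreover have "A \<le> C * (6 * (A - B))"
    using poincare[OF assms] unfolding energy_eq A_def B_def .
  then have "A / (12 * C) \<le> (A - B) / 2" using C_ge_1 by (simp add: field_simps)
  ultimately have "(\<Sum>u<n. (Q f u)\<^sup>2) \<le> A - A / (12 * C)" by argo
  then show ?thesis by (simp add: A_def algebra_simps)
qed

lemma funpow_Q_contract:
  assumes "(\<Sum>u<n. f u) = 0"
  shows "(\<Sum>u<n. ((Q ^^ t) f u)\<^sup>2) \<le> (1 - 1 / (12 * C)) ^ t * (\<Sum>u<n. (f u)\<^sup>2)"
proof (induction t)
  case (Suc t)
  have "(\<Sum>u<n. (Q ^^ t) f u) = 0" using assms by (simp add: sum_funpow_Q)
  then have "(\<Sum>u<n. ((Q ^^ Suc t) f u)\<^sup>2) \<le> (1 - 1 / (12 * C)) * (\<Sum>u<n. ((Q ^^ t) f u)\<^sup>2)"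
    by (simp add: Q_contract)
  also have "\<dots> \<le> (1 - 1 / (12 * C)) * ((1 - 1 / (12 * C)) ^ t * (\<Sum>u<n. (f u)\<^sup>2))"
    using C_ge_1 by (intro mult_left_mono Suc) (simp add: field_simps)
  finally show ?case by (simp add: mult.assoc)
qed simp

text \<open>For the centred point mass \<open>f\<close>, the value of
  \<open>(Q ^^ (2 * t)) f\<close> at \<open>x\<close> is the squared norm of
  \<open>(Q ^^ t) f\<close>, which decays geometrically from at most 1.\<close>

lemma lazy_return_prob:
  assumes "x < n"
  shows "(Q ^^ (2 * t)) (\<delta> x) x \<le> 1 / real n + (1 - 1 / (12 * C)) ^ t"
proof -
  define f where "f = (\<lambda>u. \<delta> x u - 1 / real n)"
  have sf: "(\<Sum>u<n. f u) = 0" using assms by (simp add: f_def sum_subtractf sum_\<delta>)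
  have Qf: "(Q ^^ t) f u = (Q ^^ t) (\<delta> x) u - 1 / real n" for t u
    by (simp add: f_def funpow_Q_diff funpow_Q_const)
  \<comment> \<open>Mean-zero functions do not see the constant part of \<open>f\<close>, so
    \<open>f\<close> evaluates them like \<open>\<delta> x\<close>.\<close>
  have inner: "(\<Sum>u<n. f u * g u) = g x" if "(\<Sum>u<n. g u) = 0" for g
    using assms that
    by (simp add: f_def left_diff_distrib sum_subtractf sum_\<delta> sum_divide_distrib[symmetric])
  have "f x \<le> 1" by (simp add: f_def \<delta>_def)
  then have "(\<Sum>u<n. (f u)\<^sup>2) \<le> 1" using inner[OF sf] by (simp add: power2_eq_square)
  moreover have "(1 - 1 / (12 * C)) ^ t \<ge> 0" using C_ge_1 by (simp add: field_simps)
  ultimately have "(\<Sum>u<n. ((Q ^^ t) f u)\<^sup>2) \<le> (1 - 1 / (12 * C)) ^ t"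
    using funpow_Q_contract[OF sf, of t] by (meson mult_left_le order_trans)
  moreover have "(\<Sum>u<n. ((Q ^^ t) f u)\<^sup>2) = (\<Sum>u<n. f u * (Q ^^ (2 * t)) f u)"
    using funpow_Q_selfadjoint[of f t "(Q ^^ t) f"] by (simp add: power2_eq_square mult_2 funpow_add)
  moreover have "\<dots> = (Q ^^ (2 * t)) f x"
    by (intro inner) (simp add: sum_funpow_Q sf)
  ultimately show ?thesis using Qf[of "2 * t" x] by simp
qed

text \<open>The binomial theorem for \<open>Q = (1 + P) / 2\<close>: in \<open>t\<close> lazy steps
  the walk makes a Binomial(t, 1/2) number of proper ones.\<close>

lemma Q_binomial:
  "(Q ^^ t) f u = (\<Sum>j\<le>t. real (t choose j) * (P ^^ j) f u) / 2 ^ t"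
proof (induction t arbitrary: u)
  case (Suc t)
  have P_sum: "P (\<lambda>u. (\<Sum>j\<le>t. real (t choose j) * (P ^^ j) f u) / 2 ^ t) u
      = (\<Sum>j\<le>t. real (t choose j) * (P ^^ Suc j) f u) / 2 ^ t" for u
  proof -
    have lin: "P (\<lambda>u. (\<Sum>j\<in>J. g j u) / c) u = (\<Sum>j\<in>J. P (g j) u) / c" for J c and g :: "nat \<Rightarrow> nat \<Rightarrow> real"
      unfolding P_def sum_divide_distrib by (subst sum.swap) (simp add: mult.commute)
    show ?thesis by (simp add: lin P_cmult)
  qed
  have "(Q ^^ Suc t) f u = ((\<Sum>j\<le>t. real (t choose j) * (P ^^ j) f u)
      + (\<Sum>j\<le>t. real (t choose j) * (P ^^ Suc j) f u)) / 2 ^ Suc t"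
    unfolding funpow.simps comp_def Q_def Suc[abs_def] P_sum by (simp add: add_divide_distrib)
  also have "(\<Sum>j\<le>t. real (t choose j) * (P ^^ j) f u) = (\<Sum>j\<le>Suc t. real (t choose j) * (P ^^ j) f u)"
    by simp
  also have "\<dots> = f u + (\<Sum>j\<le>t. real (t choose Suc j) * (P ^^ Suc j) f u)"
    by (subst sum.atMost_Suc_shift) simp
  also have "f u + (\<Sum>j\<le>t. real (t choose Suc j) * (P ^^ Suc j) f u)
      + (\<Sum>j\<le>t. real (t choose j) * (P ^^ Suc j) f u)
    = (\<Sum>j\<le>Suc t. real (Suc t choose j) * (P ^^ j) f u)"
    by (subst sum.atMost_Suc_shift) (simp add: sum.distrib algebra_simps)
  finally show ?case .
qed simp

text \<open>Half of the binomial weight lies on even \<open>j\<close>, exactly because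
  \<open>t > 0\<close>. There the return probability is at least that at \<open>2 * t\<close> by
  monotonicity; the odd terms are nonnegative.\<close>

lemma return_prob_le_lazy:
  assumes "x < n" "t > 0"
  shows "(P ^^ (2 * t)) (\<delta> x) x \<le> 2 * (Q ^^ (2 * t)) (\<delta> x) x"
proof -
  let ?p = "(P ^^ (2 * t)) (\<delta> x) x"
  have "2 ^ (2 * t) * ?p = 2 * (\<Sum>j\<le>2 * t. if even j then real (2 * t choose j) else 0) * ?p"
    using choose_even_sum[of "2 * t", where 'a = real] assms(2) by simp
  also have "\<dots> \<le> 2 * (\<Sum>j\<le>2 * t. real (2 * t choose j) * (P ^^ j) (\<delta> x) x)"
  proof -
    have "(if even j then real (2 * t choose j) else 0) * ?p \<le> real (2 * t choose j) * (P ^^ j) (\<delta> x) x"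
      if "j \<le> 2 * t" for j
    proof (cases "even j")
      case True
      then obtain s where s: "j = 2 * s" by blast
      then show ?thesis
        using return_prob_antimono[OF assms(1), of s t] that by (simp add: mult_left_mono)
    qed (simp add: funpow_P_nonneg \<delta>_nonneg)
    then show ?thesis
      unfolding mult.assoc[of 2] sum_distrib_right by (intro mult_left_mono sum_mono) auto
  qed
  finally show ?thesis by (simp add: Q_binomial field_simps)
qed

section \<open>The random walk as a chain and its stationary law\<close>

lemma pmf_srw: "u < n \<Longrightarrow> pmf (srw G u) v = (\<Sum>i<3. of_bool (v = \<sigma> i u)) / 3"
proof -
  assume u: "u < n"
  have "pmf (srw G u) v = indicator ((\<lambda>i. \<sigma> i u) ` {..<3}) v / 3"
    using card_neighbours_G[OF u] unfolding srw_def neighbours_G[OF u]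
    by (subst pmf_of_set) (auto simp: lessThan_empty_iff)
  also have "indicator ((\<lambda>i. \<sigma> i u) ` {..<3}) v = (\<Sum>i<3. of_bool (v = \<sigma> i u) :: real)"
    using \<sigma>_inj[OF _ _ u, of 0 1] \<sigma>_inj[OF _ _ u, of 0 2] \<sigma>_inj[OF _ _ u, of 1 2]
    by (simp add: eval_nat_numeral lessThan_Suc indicator_def del: sum_of_bool_eq) auto
  finally show ?thesis .
qed

lemma set_pmf_srw: "u < n \<Longrightarrow> set_pmf (srw G u) \<subseteq> {..<n}"
  unfolding srw_def neighbours_G by (subst set_pmf_of_set) (auto simp: \<sigma>_less lessThan_empty_iff)

text \<open>A step of the chain is the transpose of \<open>P\<close> on probability vectors, hence
  \<open>P\<close> itself by self-adjointness.\<close>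

lemma pmf_bind_srw:
  assumes "set_pmf \<mu> \<subseteq> {..<n}" "y < n"
  shows "pmf (bind_pmf \<mu> (srw G)) y = P (pmf \<mu>) y"
proof -
  have "pmf (bind_pmf \<mu> (srw G)) y = (\<Sum>u<n. pmf \<mu> u * pmf (srw G u) y)"
    unfolding pmf_bind using assms(1)
    by (subst integral_measure_pmf[of "{..<n}"]) auto
  also have "\<dots> = (\<Sum>u<n. pmf \<mu> u * P (\<delta> y) u)"
    by (intro sum.cong refl) (simp add: pmf_srw P_def \<delta>_def eq_commute del: sum_of_bool_eq)
  also have "\<dots> = P (pmf \<mu>) y"
    using assms(2) by (simp add: P_selfadjoint sum_\<delta>)
  finally show ?thesis .
qed

lemma P_cong: "(\<And>v. v < n \<Longrightarrow> f v = g v) \<Longrightarrow> u < n \<Longrightarrow> P f u = P g u"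
  by (simp add: P_def \<sigma>_less)

lemma chain_dist_Suc: "chain_dist K x (Suc t) = bind_pmf (chain_dist K x t) K"
  by (simp add: chain_dist_def)

lemma set_pmf_chain_dist: "x < n \<Longrightarrow> set_pmf (chain_dist (srw G) x t) \<subseteq> {..<n}"
proof (induction t)
  case (Suc t)
  then show ?case using set_pmf_srw by (fastforce simp: chain_dist_Suc)
qed (simp add: chain_dist_def)

lemma pmf_chain_dist: "x < n \<Longrightarrow> y < n \<Longrightarrow> pmf (chain_dist (srw G) x t) y = (P ^^ t) (\<delta> x) y"
proof (induction t arbitrary: y)
  case (Suc t)
  have "P (pmf (chain_dist (srw G) x t)) y = P ((P ^^ t) (\<delta> x)) y"
    using Suc by (intro P_cong) auto
  then show ?case using Suc.prems by (simp add: chain_dist_Suc pmf_bind_srw[OF set_pmf_chain_dist])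
qed (simp add: chain_dist_def \<delta>_def indicator_def)

text \<open>A harmonic function has no energy, so the Poincare inequality annihilates it. Uniqueness
  of the stationary law and connectedness both rest on this.\<close>

lemma harmonic_const:
  assumes "(\<Sum>u<n. f u) = 0" "\<And>u. u < n \<Longrightarrow> P f u = f u" "u < n"
  shows "f u = 0"
proof -
  have "(\<Sum>u<n. (f u)\<^sup>2) \<le> 0"
    using poincare[OF assms(1)] unfolding energy_eq by (simp add: assms(2) power2_eq_square)
  then have "(\<Sum>u<n. (f u)\<^sup>2) = 0" by (intro antisym sum_nonneg) auto
  then show ?thesis using assms(3) by (simp add: sum_nonneg_eq_0_iff)
qed

text \<open>\<open>stationary_dist\<close> is a definite description, so uniqueness is needed too: a
  stationary law minus the uniform one is harmonic of mean zero.\<close>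

lemma stationary: "stationary_dist {..<n} (srw G) = pmf_of_set {..<n}"
  unfolding stationary_dist_def
proof (rule the_equality)
  have ne: "{..<n} \<noteq> {}" using n_ge_2 by (simp add: lessThan_empty_iff)
  have unif: "pmf (pmf_of_set {..<n}) u = 1 / real n" if "u < n" for u
    using that ne by simp
  show "set_pmf (pmf_of_set {..<n}) \<subseteq> {..<n} \<and> bind_pmf (pmf_of_set {..<n}) (srw G) = pmf_of_set {..<n}"
  proof (intro conjI pmf_eqI)
    show *: "set_pmf (pmf_of_set {..<n}) \<subseteq> {..<n}" using ne by simp
    fix y
    show "pmf (bind_pmf (pmf_of_set {..<n}) (srw G)) y = pmf (pmf_of_set {..<n}) y"
    proof (cases "y < n")
      case True
      have "P (pmf (pmf_of_set {..<n})) y = P (\<lambda>_. 1 / real n) y"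
        using True by (intro P_cong) (auto simp: unif)
      then show ?thesis using True by (simp add: pmf_bind_srw[OF *] unif P_const)
    next
      case False
      have "set_pmf (bind_pmf (pmf_of_set {..<n}) (srw G)) \<subseteq> {..<n}"
        unfolding set_bind_pmf using * set_pmf_srw by blast
      then have "pmf (bind_pmf (pmf_of_set {..<n}) (srw G)) y = 0"
        using False by (intro pmf_eq_0_set_pmf[THEN iffD2]) auto
      then show ?thesis using False ne by simp
    qed
  qed
  fix \<pi> assume \<pi>: "set_pmf \<pi> \<subseteq> {..<n} \<and> bind_pmf \<pi> (srw G) = \<pi>"
  have "pmf \<pi> u - 1 / real n = 0" if "u < n" for u
  proof (rule harmonic_const[OF _ _ that])
    show "(\<Sum>u<n. pmf \<pi> u - 1 / real n) = 0"
      using \<pi> n_ge_2 by (simp add: sum_subtractf sum_pmf_eq_1)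
    show "P (\<lambda>u. pmf \<pi> u - 1 / real n) u = pmf \<pi> u - 1 / real n" if "u < n" for u
      using pmf_bind_srw[of \<pi> u] \<pi> that by (simp add: P_diff P_const)
  qed
  then show "\<pi> = pmf_of_set {..<n}"
  proof (intro pmf_eqI)
    fix u
    show "pmf \<pi> u = pmf (pmf_of_set {..<n}) u" if "\<And>u. u < n \<Longrightarrow> pmf \<pi> u - 1 / real n = 0"
    proof (cases "u < n")
      case True
      then show ?thesis using that[of u] unif[of u] by simp
    next
      case False
      then have "u \<notin> set_pmf \<pi>" using \<pi> by auto
      then show ?thesis using False ne by (simp add: set_pmf_iff)
    qed
  qed
qed

lemma tv_dist_eq:
  "x < n \<Longrightarrow> tv_dist {..<n} (chain_dist (srw G) x t) (stationary_dist {..<n} (srw G))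
    = (\<Sum>y<n. \<bar>(P ^^ t) (\<delta> x) y - 1 / real n\<bar>) / 2"
  unfolding tv_dist_def stationary using n_ge_2 by (simp add: pmf_chain_dist lessThan_empty_iff)

lemma worst_dist_less_iff:
  "worst_dist {..<n} (srw G) t < \<epsilon> \<longleftrightarrow>
    (\<forall>x<n. (\<Sum>y<n. \<bar>(P ^^ t) (\<delta> x) y - 1 / real n\<bar>) / 2 < \<epsilon>)"
  unfolding worst_dist_def using n_ge_2 by (subst Max_less_iff) (auto simp: tv_dist_eq lessThan_empty_iff)

section \<open>Early overlap with the uniform distribution\<close>

text \<open>A small l2 norm forces spreading: the linear term is traded for a multiple of the
  square, whose sum is the return probability. With \<open>4 / n\<close> the l1 distance is at most
  3/2, short of the maximal 2.\<close>

lemma tv_le_of_return_prob: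
  assumes "x < n" "(P ^^ (2 * t)) (\<delta> x) x \<le> 4 / real n"
  shows "(\<Sum>y<n. \<bar>(P ^^ t) (\<delta> x) y - 1 / real n\<bar>) / 2 \<le> 3 / 4"
proof -
  define \<mu> where "\<mu> = (P ^^ t) (\<delta> x)"
  have n: "real n > 0" using n_ge_2 by simp
  have "\<bar>\<mu> y - 1 / real n\<bar> \<le> 1 / real n + real n / 8 * (\<mu> y)\<^sup>2" for y
  proof (cases "\<mu> y \<le> 1 / real n")
    case True
    moreover have "\<mu> y \<ge> 0" unfolding \<mu>_def by (intro funpow_P_nonneg \<delta>_nonneg)
    moreover have "real n / 8 * (\<mu> y)\<^sup>2 \<ge> 0" by simp
    ultimately show ?thesis by linarith
  next
    case False
    \<comment> \<open>The parabola \<open>2 / n + n / 8 * (\<mu> y)\<^sup>2\<close> lies above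
      \<open>\<mu> y\<close> and touches it at \<open>4 / n\<close>.\<close>
    have "0 \<le> (real n * \<mu> y - 4)\<^sup>2 / (8 * real n)" by simp
    also have "\<dots> = 2 / real n + real n / 8 * (\<mu> y)\<^sup>2 - \<mu> y"
      using n by (simp add: power2_eq_square field_simps)
    finally show ?thesis using False by simp
  qed
  then have "(\<Sum>y<n. \<bar>\<mu> y - 1 / real n\<bar>) \<le> (\<Sum>y<n. 1 / real n + real n / 8 * (\<mu> y)\<^sup>2)"
    by (intro sum_mono)
  also have "\<dots> = 1 + real n / 8 * (P ^^ (2 * t)) (\<delta> x) x"
    using n return_prob[OF assms(1), of t] by (simp add: sum.distrib sum_distrib_left \<mu>_def)
  also have "\<dots> \<le> 1 + real n / 8 * (4 / real n)"
    using assms(2) by (intro add_left_mono mult_left_mono) auto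
  also have "\<dots> = 3 / 2" using n by simp
  finally show ?thesis by (simp add: \<mu>_def)
qed

text \<open>Both terms of \<open>lazy_return_prob\<close> are at most \<open>1 / n\<close>, and the
  comparison with the lazy walk doubles their sum: this is the \<open>4 / n\<close> of
  \<open>tv_le_of_return_prob\<close>.\<close>

lemma t_mix_upper:
  assumes "t > 0" "(1 - 1 / (12 * C)) ^ t \<le> 1 / real n" "\<epsilon> > 3 / 4"
  shows "t_mix {..<n} (srw G) \<epsilon> \<le> t"
proof -
  have "worst_dist {..<n} (srw G) t < \<epsilon>"
    unfolding worst_dist_less_iff
  proof (intro allI impI)
    fix x assume x: "x < n"
    have "(P ^^ (2 * t)) (\<delta> x) x \<le> 4 / real n"
      using return_prob_le_lazy[OF x assms(1)] lazy_return_prob[OF x, of t] assms(2) by argo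
    then show "(\<Sum>y<n. \<bar>(P ^^ t) (\<delta> x) y - 1 / real n\<bar>) / 2 < \<epsilon>"
      using tv_le_of_return_prob[OF x, of t] assms(3) by linarith
  qed
  then show ?thesis unfolding t_mix_def by (rule Least_le)
qed

section \<open>Persistence of parity\<close>

text \<open>Useful when \<open>s\<close> is nearly an eigenvector for -1. As \<open>P\<close>
  contracts the l1 norm, each step adds at most the l1 norm of \<open>P s + s\<close> to the
  distance of \<open>(P ^^ t) s\<close> from \<open>(-1) ^ t * s\<close>.\<close>

lemma parity_persists:
  assumes s: "\<And>u. u < n \<Longrightarrow> \<bar>s u\<bar> = 1"
  shows "real n - real t * (\<Sum>u<n. \<bar>P s u + s u\<bar>) \<le> (\<Sum>u<n. \<bar>(P ^^ t) s u\<bar>)"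
proof -
  define D where "D = (\<Sum>u<n. \<bar>P s u + s u\<bar>)"
  have l1: "(\<Sum>u<n. \<bar>P f u\<bar>) \<le> (\<Sum>u<n. \<bar>f u\<bar>)" for f
  proof -
    have "\<bar>P f u\<bar> \<le> P (\<lambda>v. \<bar>f v\<bar>) u" for u
      by (simp add: P_def abs_divide divide_right_mono sum_abs)
    then show ?thesis using sum_mono[of "{..<n}"] sum_P by metis
  qed
  have l1_pow: "(\<Sum>u<n. \<bar>(P ^^ t) f u\<bar>) \<le> (\<Sum>u<n. \<bar>f u\<bar>)" for f t
    by (induction t) (auto intro: order_trans[OF l1])
  have "(\<Sum>u<n. \<bar>(P ^^ t) s u - (-1) ^ t * s u\<bar>) \<le> real t * D"
  proof (induction t)
    case (Suc t)
    have "(P ^^ Suc t) s u - (-1) ^ Suc t * s u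
        = P (\<lambda>u. (P ^^ t) s u - (-1) ^ t * s u) u + (-1) ^ t * (P s u + s u)" for u
      unfolding P_diff P_cmult by (simp add: algebra_simps)
    moreover have "\<bar>(-1) ^ t * (P s u + s u)\<bar> = \<bar>P s u + s u\<bar>" for u
      by (simp add: abs_mult power_abs)
    ultimately have "\<bar>(P ^^ Suc t) s u - (-1) ^ Suc t * s u\<bar>
      \<le> \<bar>P (\<lambda>u. (P ^^ t) s u - (-1) ^ t * s u) u\<bar> + \<bar>P s u + s u\<bar>" for u
      using abs_triangle_ineq[of "P (\<lambda>u. (P ^^ t) s u - (-1) ^ t * s u) u" "(-1) ^ t * (P s u + s u)"]
      by presburger
    then have "(\<Sum>u<n. \<bar>(P ^^ Suc t) s u - (-1) ^ Suc t * s u\<bar>)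
      \<le> (\<Sum>u<n. \<bar>P (\<lambda>u. (P ^^ t) s u - (-1) ^ t * s u) u\<bar> + \<bar>P s u + s u\<bar>)"
      by (intro sum_mono)
    also have "\<dots> \<le> real t * D + D"
      unfolding sum.distrib using Suc l1[of "\<lambda>u. (P ^^ t) s u - (-1) ^ t * s u"]
      by (simp add: D_def)
    finally show ?case by (simp add: algebra_simps)
  qed simp
  moreover have "(\<Sum>u<n. 1 - \<bar>(P ^^ t) s u - (-1) ^ t * s u\<bar>) \<le> (\<Sum>u<n. \<bar>(P ^^ t) s u\<bar>)"
  proof (intro sum_mono)
    fix u assume "u \<in> {..<n}"
    then have "\<bar>(-1) ^ t * s u\<bar> = 1" using s by (simp add: abs_mult power_abs)
    then show "1 - \<bar>(P ^^ t) s u - (-1) ^ t * s u\<bar> \<le> \<bar>(P ^^ t) s u\<bar>" by linarith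
  qed
  ultimately show ?thesis by (simp add: sum_subtractf D_def)
qed

text \<open>\<open>s\<close> is a test function: having mean zero and modulus 1, it makes the
  modulus of \<open>(P ^^ t) s x\<close> at most twice the distance to equilibrium from
  \<open>x\<close>. Summing over \<open>x\<close> meets the bound of
  \<open>parity_persists\<close>.\<close>

lemma worst_dist_lower:
  assumes s: "\<And>u. u < n \<Longrightarrow> \<bar>s u\<bar> = 1" and mean: "(\<Sum>u<n. s u) = 0"
    and "worst_dist {..<n} (srw G) t < \<epsilon>"
  shows "real n * (1 - 2 * \<epsilon>) < real t * (\<Sum>u<n. \<bar>P s u + s u\<bar>)"
proof -
  have "\<bar>(P ^^ t) s x\<bar> < 2 * \<epsilon>" if x: "x < n" for x
  proof -
    have "(P ^^ t) s x = (\<Sum>y<n. ((P ^^ t) (\<delta> x) y - 1 / real n) * s y)"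
      using mean by (simp add: funpow_P_eq_kernel[OF x] left_diff_distrib sum_subtractf
          sum_divide_distrib[symmetric])
    also have "\<bar>\<dots>\<bar> \<le> (\<Sum>y<n. \<bar>((P ^^ t) (\<delta> x) y - 1 / real n) * s y\<bar>)" by (rule sum_abs)
    also have "\<dots> = (\<Sum>y<n. \<bar>(P ^^ t) (\<delta> x) y - 1 / real n\<bar>)"
      by (intro sum.cong refl) (simp add: abs_mult s)
    also have "\<dots> < 2 * \<epsilon>" using assms(3) x unfolding worst_dist_less_iff by fastforce
    finally show ?thesis .
  qed
  then have "(\<Sum>u<n. \<bar>(P ^^ t) s u\<bar>) < (\<Sum>u<n. 2 * \<epsilon>)"
    using n_ge_2 by (intro sum_strict_mono) (auto simp: lessThan_empty_iff)
  then show ?thesis using parity_persists[where s = s and t = t, OF s] by (simp add: algebra_simps)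
qed

section \<open>Irreducibility, aperiodicity and convergence\<close>

lemma step_pos: "u < n \<Longrightarrow> i < 3 \<Longrightarrow> (\<And>v. f v \<ge> 0) \<Longrightarrow> f u > 0 \<Longrightarrow> P f (\<sigma> i u) > 0"
proof -
  assume u: "u < n" "i < 3" and f: "\<And>v. f v \<ge> 0" "f u > 0"
  have "0 < (\<Sum>j<3. f (\<sigma> j (\<sigma> i u)))"
    using u f by (intro sum_pos2[of _ i]) (auto simp: \<sigma>_invol)
  then show ?thesis by (simp add: P_def)
qed

lemma kernel_step_pos:
  "u < n \<Longrightarrow> i < 3 \<Longrightarrow> (P ^^ t) (\<delta> x) u > 0 \<Longrightarrow> (P ^^ Suc t) (\<delta> x) (\<sigma> i u) > 0"
  by (simp add: step_pos funpow_P_nonneg \<delta>_nonneg)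

text \<open>Two steps can always be spent along an edge of matching 0 and back.\<close>

lemma kernel_double_step_pos:
  assumes "u < n" "(P ^^ t) (\<delta> x) u > 0" shows "(P ^^ (t + 2 * k)) (\<delta> x) u > 0"
proof (induction k)
  case (Suc k)
  then show ?case
    using kernel_step_pos[of "\<sigma> 0 u" 0 "Suc (t + 2 * k)" x] kernel_step_pos[of u 0 "t + 2 * k" x]
    by (simp add: assms(1) \<sigma>_invol \<sigma>_less)
qed (simp add: assms)

lemma kernel_compose_pos:
  assumes "x < n" "y < n" "z < n" "(P ^^ s) (\<delta> x) y > 0" "(P ^^ t) (\<delta> y) z > 0"
  shows "(P ^^ (s + t)) (\<delta> x) z > 0"
proof -
  have "(P ^^ (s + t)) (\<delta> x) z = (\<Sum>w<n. (P ^^ t) (\<delta> z) w * (P ^^ s) (\<delta> x) w)"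
    using funpow_P_eq_kernel[OF assms(3), of t "(P ^^ s) (\<delta> x)"]
    by (simp add: add.commute[of s t] funpow_add)
  also have "\<dots> > 0"
    using assms kernel_sym[of y z t]
    by (intro sum_pos2[of _ y]) (auto simp: funpow_P_nonneg \<delta>_nonneg)
  finally show ?thesis .
qed

text \<open>The centred indicator of a set closed under the matchings is harmonic, hence zero, so
  the set has density 1.\<close>

lemma connected_set:
  assumes "S \<subseteq> {..<n}" "S \<noteq> {}" "\<And>u i. u \<in> S \<Longrightarrow> i < 3 \<Longrightarrow> \<sigma> i u \<in> S"
  shows "S = {..<n}"
proof -
  define f :: "nat \<Rightarrow> real" where "f u = of_bool (u \<in> S) - real (card S) / real n" for u
  have inv: "\<sigma> i u \<in> S \<longleftrightarrow> u \<in> S" if "u < n" "i < 3" for u i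
    using assms(3)[of u i] assms(3)[of "\<sigma> i u" i] that by (auto simp: \<sigma>_invol)
  have "f u = 0" if "u < n" for u
  proof (rule harmonic_const[OF _ _ that])
    show "(\<Sum>u<n. f u) = 0"
      using assms(1) n_ge_2 by (simp add: f_def sum_subtractf Int_absorb1)
    show "P f u = f u" if "u < n" for u
      using inv[OF that] by (simp add: P_def f_def)
  qed
  moreover obtain v where "v \<in> S" using assms(2) by blast
  ultimately have "real (card S) / real n = 1" using assms(1) by (force simp: f_def)
  then have "card S = n" using n_ge_2 by simp
  then show ?thesis using assms(1) by (intro card_subset_eq) auto
qed

lemma reachable:
  assumes "x < n" "y < n" obtains t where "(P ^^ t) (\<delta> x) y > 0"
proof -
  define S where "S = {u. u < n \<and> (\<exists>t. (P ^^ t) (\<delta> x) u > 0)}"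
  have "(P ^^ 0) (\<delta> x) x > 0" by (simp add: \<delta>_def)
  then have "x \<in> S" unfolding S_def using assms(1) by blast
  moreover have "\<sigma> i u \<in> S" if "u \<in> S" "i < 3" for u i
    using that kernel_step_pos[of u i] \<sigma>_less[of i u] unfolding S_def by blast
  ultimately have "S = {..<n}" by (intro connected_set) (auto simp: S_def)
  then show ?thesis using assms(2) that by (auto simp: S_def)
qed

lemma triangle_pos: "(P ^^ 3) (\<delta> 0) 0 > 0"
proof -
  have "(P ^^ 0) (\<delta> 0) 0 > 0" by (simp add: \<delta>_def)
  then have "(P ^^ Suc 0) (\<delta> 0) 2 > 0" using kernel_step_pos[of 0 1 0 0] triangle by simp
  then have "(P ^^ Suc (Suc 0)) (\<delta> 0) 3 > 0" using kernel_step_pos[of 2 0 "Suc 0" 0] triangle by simp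
  then have "(P ^^ Suc (Suc (Suc 0))) (\<delta> 0) 0 > 0"
    using kernel_step_pos[of 3 2 "Suc (Suc 0)" 0] triangle by simp
  then show ?thesis by (simp add: numeral_3_eq_3)
qed

lemma irreducible: "irreducible_chain {..<n} (srw G)"
  unfolding irreducible_chain_def by (auto simp: pmf_chain_dist intro: reachable)

text \<open>From \<open>x\<close> to 0, once around the triangle, and back by symmetry in the same
  number of steps.\<close>

lemma odd_return:
  assumes "x < n" obtains t where "(P ^^ (2 * t + 3)) (\<delta> x) x > 0"
proof -
  have 0: "0 < n" using n_ge_2 by simp
  obtain t where t: "(P ^^ t) (\<delta> x) 0 > 0" using reachable[OF assms 0] .
  have "(P ^^ (t + 3 + t)) (\<delta> x) x > 0"
    using t kernel_sym[OF assms 0, of t] triangle_pos assms 0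
    by (intro kernel_compose_pos[of x 0 x] kernel_compose_pos[of x 0 0]) auto
  moreover have "t + 3 + t = 2 * t + 3" by simp
  ultimately show ?thesis using that by metis
qed

lemma aperiodic: "aperiodic_chain {..<n} (srw G)"
  unfolding aperiodic_chain_def
proof
  fix x assume "x \<in> {..<n}"
  then have x: "x < n" by simp
  let ?T = "{t. t > 0 \<and> pmf (chain_dist (srw G) x t) x > 0}"
  obtain t where t: "(P ^^ (2 * t + 3)) (\<delta> x) x > 0" using odd_return[OF x] .
  have "(P ^^ 2) (\<delta> x) x > 0"
    using kernel_double_step_pos[of x 0 x 1] x by (simp add: \<delta>_def numeral_2_eq_2)
  then have "2 \<in> ?T" using pmf_chain_dist[OF x x, of 2] by simp
  moreover have "2 * t + 3 \<in> ?T" using pmf_chain_dist[OF x x, of "2 * t + 3"] t by simp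
  ultimately have "Gcd ?T dvd 2" "Gcd ?T dvd 2 * t + 3" by (auto intro: Gcd_dvd)
  then have "Gcd ?T dvd (2 * t + 3) - 2 * (t + 1)" by (intro dvd_diff_nat dvd_mult2) auto
  then show "Gcd ?T = 1" by simp
qed

text \<open>By \<open>odd_return\<close> there are walks from \<open>x\<close> to \<open>y\<close>
  of both parities, and each can be lengthened by any even number; a time beyond the finitely many
  thresholds serves all pairs.\<close>

lemma kernel_eventually_pos:
  obtains T where "\<And>x y. x < n \<Longrightarrow> y < n \<Longrightarrow> (P ^^ T) (\<delta> x) y > 0"
proof -
  have "\<exists>t. \<forall>s\<ge>t. (P ^^ s) (\<delta> x) y > 0" if x: "x < n" and y: "y < n" for x y
  proof -
    obtain a where a: "(P ^^ a) (\<delta> x) y > 0" using reachable[OF x y] .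
    obtain b where b: "(P ^^ (2 * b + 3)) (\<delta> x) x > 0" using odd_return[OF x] .
    have c: "(P ^^ (2 * b + 3 + a)) (\<delta> x) y > 0"
      by (rule kernel_compose_pos[OF x x y b a])
    have "(P ^^ s) (\<delta> x) y > 0" if s: "s \<ge> 2 * b + 3 + a" for s
    proof (cases "even (s - a)")
      case True
      then obtain k where "s - a = 2 * k" by blast
      then have "s = a + 2 * k" using s by simp
      then show ?thesis using kernel_double_step_pos[OF y a] by simp
    next
      case False
      then have "even (s - (2 * b + 3 + a))" using s by (simp add: even_diff_nat)
      then obtain k where "s - (2 * b + 3 + a) = 2 * k" by blast
      then have "s = 2 * b + 3 + a + 2 * k" using s by simp
      then show ?thesis using kernel_double_step_pos[OF y c] by simp
    qed
    then show ?thesis by blast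
  qed
  then obtain t where t: "\<And>x y s. x < n \<Longrightarrow> y < n \<Longrightarrow> s \<ge> t x y \<Longrightarrow> (P ^^ s) (\<delta> x) y > 0"
    by metis
  show ?thesis
  proof (rule that)
    fix x y assume "x < n" "y < n"
    then have "t x y \<le> (\<Sum>x<n. \<Sum>y<n. t x y)"
      by (intro order_trans[OF member_le_sum[of y "{..<n}" "t x"]] member_le_sum[of x]) auto
    then show "(P ^^ (\<Sum>x<n. \<Sum>y<n. t x y)) (\<delta> x) y > 0"
      using t \<open>x < n\<close> \<open>y < n\<close> by blast
  qed
qed

text \<open>Doeblin's argument. It guarantees that the \<open>LEAST\<close> in \<open>t_mix\<close>
  is attained at every level, where the overlap bound covers only levels above 3/4.\<close>

lemma worst_dist_eventually_less:
  assumes "\<epsilon> > 0" obtains t where "worst_dist {..<n} (srw G) t < \<epsilon>"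
proof -
  obtain T where T: "\<And>x y. x < n \<Longrightarrow> y < n \<Longrightarrow> (P ^^ T) (\<delta> x) y > 0"
    using kernel_eventually_pos by blast
  define \<alpha> where "\<alpha> = Min ((\<lambda>(x, y). (P ^^ T) (\<delta> x) y) ` ({..<n} \<times> {..<n}))"
  have ne: "{..<n} \<noteq> {}" using n_ge_2 by (simp add: lessThan_empty_iff)
  have \<alpha>_le: "\<alpha> \<le> (P ^^ T) (\<delta> x) y" if "x < n" "y < n" for x y
    unfolding \<alpha>_def using that by (intro Min_le) auto
  have "\<alpha> > 0" unfolding \<alpha>_def using T ne by (subst Min_gr_iff) auto
  define \<rho> where "\<rho> = 1 - real n * \<alpha>"
  have "real n * \<alpha> = (\<Sum>y<n. \<alpha>)" by simp
  also have "\<dots> \<le> (\<Sum>y<n. (P ^^ T) (\<delta> 0) y)" using \<alpha>_le n_ge_2 by (intro sum_mono) auto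
  also have "\<dots> = 1" using n_ge_2 by (simp add: sum_funpow_P sum_\<delta>)
  finally have \<rho>: "0 \<le> \<rho>" "\<rho> < 1" using \<open>\<alpha> > 0\<close> n_ge_2 by (auto simp: \<rho>_def)
  \<comment> \<open>On mean-zero functions the constant \<open>\<alpha>\<close> may be subtracted
    from the kernel; what remains is nonnegative with row and column sums
    \<open>\<rho>\<close>.\<close>
  have doeblin: "(\<Sum>y<n. \<bar>(P ^^ T) f y\<bar>) \<le> \<rho> * (\<Sum>y<n. \<bar>f y\<bar>)" if "(\<Sum>y<n. f y) = 0" for f
  proof -
    have "\<bar>(P ^^ T) f y\<bar> \<le> (\<Sum>x<n. ((P ^^ T) (\<delta> y) x - \<alpha>) * \<bar>f x\<bar>)" if y: "y < n" for y
    proof -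
      have "(P ^^ T) f y = (\<Sum>x<n. ((P ^^ T) (\<delta> y) x - \<alpha>) * f x)"
        using \<open>(\<Sum>y<n. f y) = 0\<close>
        by (simp add: funpow_P_eq_kernel[OF y] left_diff_distrib sum_subtractf sum_distrib_left[symmetric])
      also have "\<bar>\<dots>\<bar> \<le> (\<Sum>x<n. \<bar>((P ^^ T) (\<delta> y) x - \<alpha>) * f x\<bar>)" by (rule sum_abs)
      also have "\<dots> = (\<Sum>x<n. ((P ^^ T) (\<delta> y) x - \<alpha>) * \<bar>f x\<bar>)"
        using y \<alpha>_le by (intro sum.cong refl) (simp add: abs_mult)
      finally show ?thesis .
    qed
    then have "(\<Sum>y<n. \<bar>(P ^^ T) f y\<bar>) \<le> (\<Sum>y<n. \<Sum>x<n. ((P ^^ T) (\<delta> y) x - \<alpha>) * \<bar>f x\<bar>)"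
      by (intro sum_mono) auto
    also have "\<dots> = (\<Sum>x<n. (\<Sum>y<n. (P ^^ T) (\<delta> x) y - \<alpha>) * \<bar>f x\<bar>)"
      by (subst sum.swap) (simp add: sum_distrib_right kernel_sym)
    also have "\<dots> = (\<Sum>x<n. \<rho> * \<bar>f x\<bar>)"
      by (intro sum.cong refl) (simp add: sum_subtractf sum_funpow_P sum_\<delta> \<rho>_def)
    finally show ?thesis by (simp add: sum_distrib_left)
  qed
  have decay: "(\<Sum>y<n. \<bar>(P ^^ (T * k)) f y\<bar>) \<le> \<rho> ^ k * (\<Sum>y<n. \<bar>f y\<bar>)" if f: "(\<Sum>y<n. f y) = 0" for f k
  proof (induction k)
    case (Suc k)
    have "(\<Sum>y<n. \<bar>(P ^^ (T * Suc k)) f y\<bar>) \<le> \<rho> * (\<Sum>y<n. \<bar>(P ^^ (T * k)) f y\<bar>)"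
      using doeblin[of "(P ^^ (T * k)) f"] f by (simp add: funpow_add sum_funpow_P)
    also have "\<dots> \<le> \<rho> * (\<rho> ^ k * (\<Sum>y<n. \<bar>f y\<bar>))" using Suc \<rho>(1) by (rule mult_left_mono)
    finally show ?case by (simp add: mult.assoc)
  qed simp
  obtain k where k: "\<rho> ^ k < \<epsilon>" using real_arch_pow_inv[OF assms \<rho>(2)] by blast
  have "worst_dist {..<n} (srw G) (T * k) < \<epsilon>"
    unfolding worst_dist_less_iff
  proof (intro allI impI)
    fix x assume x: "x < n"
    let ?f = "\<lambda>u. \<delta> x u - 1 / real n"
    have "(\<Sum>y<n. ?f y) = 0" using x by (simp add: sum_subtractf sum_\<delta>)
    from decay[OF this, of k] have "(\<Sum>y<n. \<bar>(P ^^ (T * k)) (\<delta> x) y - 1 / real n\<bar>) \<le> \<rho> ^ k * (\<Sum>y<n. \<bar>?f y\<bar>)"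
      by (simp add: funpow_P_diff funpow_P_const)
    also have "(\<Sum>y<n. \<bar>?f y\<bar>) \<le> (\<Sum>y<n. \<delta> x y + 1 / real n)"
      by (intro sum_mono) (simp add: \<delta>_def)
    also have "\<dots> = 2" using x by (simp add: sum.distrib sum_\<delta>)
    finally show "(\<Sum>y<n. \<bar>(P ^^ (T * k)) (\<delta> x) y - 1 / real n\<bar>) / 2 < \<epsilon>"
      using k \<rho>(1) by (simp add: mult_left_mono)
  qed
  then show ?thesis by (rule that)
qed

lemma t_mix_lower:
  assumes "\<And>u. u < n \<Longrightarrow> \<bar>s u\<bar> = 1" "(\<Sum>u<n. s u) = 0" "\<epsilon> > 0"
  shows "real n * (1 - 2 * \<epsilon>) < real (t_mix {..<n} (srw G) \<epsilon>) * (\<Sum>u<n. \<bar>P s u + s u\<bar>)"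
proof -
  obtain t where "worst_dist {..<n} (srw G) t < \<epsilon>" using worst_dist_eventually_less[OF assms(3)] .
  then have "worst_dist {..<n} (srw G) (t_mix {..<n} (srw G) \<epsilon>) < \<epsilon>"
    unfolding t_mix_def by (rule LeastI)
  then show ?thesis using worst_dist_lower[OF assms(1,2)] by blast
qed

section \<open>The Cheeger constant\<close>

text \<open>Poincare for the centred indicator of \<open>S\<close>: its squared norm
  \<open>a * b / n\<close> is at least half of \<open>min a b\<close>, and its energy is controlled
  by the boundary.\<close>

lemma cheeger_lower: "cheeger G > 1 / (24 * C)"
proof -
  let ?SS = "{S. S \<noteq> {} \<and> S \<subset> {..<n}}"
  have "1 / (24 * C) < real (card (edge_boundary G S)) / real (min (card S) (card ({..<n} - S)))"
    if S: "S \<noteq> {}" "S \<subset> {..<n}" for S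
  proof -
    have fin: "finite S" using S(2) finite_subset by blast
    define a where "a = real (card S)"
    define b where "b = real (card ({..<n} - S))"
    have "card ({..<n} - S) = n - card S" "card S \<le> n"
      using S fin card_mono[of "{..<n}" S] by (auto simp: card_Diff_subset)
    then have ab: "a + b = real n" by (simp add: a_def b_def)
    have pos: "a > 0" "b > 0" using S fin by (auto simp: a_def b_def card_gt_0_iff)
    define f :: "nat \<Rightarrow> real" where "f u = of_bool (u \<in> S) - a / real n" for u
    have card_S: "(\<Sum>u<n. of_bool (u \<in> S)) = a"
      using S(2) by (simp add: a_def Int_absorb1)
    have sum_f: "(\<Sum>u<n. f u) = 0"
      using n_ge_2 by (simp add: f_def sum_subtractf card_S del: sum_of_bool_eq)
    have "(f u)\<^sup>2 = of_bool (u \<in> S) * (1 - 2 * (a / real n)) + (a / real n)\<^sup>2" for u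
      by (simp add: f_def power2_eq_square algebra_simps)
    then have "(\<Sum>u<n. (f u)\<^sup>2) = a * (1 - 2 * (a / real n)) + real n * (a / real n)\<^sup>2"
      by (simp add: sum.distrib sum_distrib_right[symmetric] card_S del: sum_of_bool_eq)
    also have "\<dots> = a * b / real n"
    proof -
      have b: "b = real n - a" using ab by simp
      show ?thesis unfolding b using n_ge_2 by (simp add: power2_eq_square field_simps)
    qed
    finally have norm_f: "(\<Sum>u<n. (f u)\<^sup>2) = a * b / real n" .
    \<comment> \<open>Orienting each boundary edge out of \<open>S\<close> replaces unordered pairs
      by arcs, one for each.\<close>
    define A where "A = {(u, v). u \<in> S \<and> v \<in> {..<n} - S \<and> (u, v) \<in> parcs G}"
    have finA: "finite A"
      by (rule finite_subset[of _ "{..<n} \<times> {..<n}"]) (use S(2) in \<open>auto simp: A_def\<close>)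
    have "edge_boundary G S = (\<lambda>(u, v). {u, v}) ` A"
    proof -
      have "(u, v) \<in> A \<longleftrightarrow> (u, v) \<in> parcs G \<and> u \<in> S \<and> v \<notin> S" for u v
        using \<sigma>_less by (auto simp: A_def parcs_G)
      then show ?thesis unfolding edge_boundary_def by (auto simp: image_iff)
    qed
    moreover have "inj_on (\<lambda>(u, v). {u, v}) A"
      by (auto simp: inj_on_def A_def doubleton_eq_iff)
    ultimately have card_A: "card (edge_boundary G S) = card A" by (simp add: card_image)
    \<comment> \<open>A crude bound: the boundary edges of one matching are estimated by the whole
      boundary, which costs a factor 3 in the energy.\<close>
    have out: "(\<Sum>u<n. of_bool (u \<in> S \<and> \<sigma> i u \<notin> S)) \<le> real (card A)" if i: "i < 3" for i
    proof -
      have "(\<Sum>u<n. of_bool (u \<in> S \<and> \<sigma> i u \<notin> S)) = real (card {u \<in> S. \<sigma> i u \<notin> S})"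
        using S(2) by (simp, intro arg_cong[of _ _ card]) auto
      also have "card {u \<in> S. \<sigma> i u \<notin> S} \<le> card A"
        by (rule card_inj_on_le[of "\<lambda>u. (u, \<sigma> i u)"])
          (use S(2) i finA in \<open>auto simp: inj_on_def A_def parcs_G \<sigma>_less subset_iff\<close>)
      finally show ?thesis by simp
    qed
    have edge: "(\<Sum>u<n. (f u - f (\<sigma> i u))\<^sup>2) \<le> 2 * real (card A)" if i: "i < 3" for i
    proof -
      have "(\<Sum>u<n. (f u - f (\<sigma> i u))\<^sup>2) = (\<Sum>u<n. of_bool (u \<in> S \<and> \<sigma> i u \<notin> S) + of_bool (\<sigma> i u \<in> S \<and> u \<notin> S))"
        by (intro sum.cong refl) (auto simp: f_def)
      also have "\<dots> = (\<Sum>u<n. of_bool (u \<in> S \<and> \<sigma> i u \<notin> S)) + (\<Sum>u<n. of_bool (\<sigma> i u \<in> S \<and> u \<notin> S))"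
        by (rule sum.distrib)
      also have "(\<Sum>u<n. of_bool (\<sigma> i u \<in> S \<and> u \<notin> S)) = (\<Sum>u<n. of_bool (u \<in> S \<and> \<sigma> i u \<notin> S) :: real)"
        using sum_\<sigma>[OF i, of "\<lambda>u. of_bool (u \<in> S \<and> \<sigma> i u \<notin> S)"] i
        by (simp add: \<sigma>_invol del: sum_of_bool_eq)
      finally show ?thesis using out[OF i] by linarith
    qed
    have "a * b / real n \<le> C * (\<Sum>i<3. \<Sum>u<n. (f u - f (\<sigma> i u))\<^sup>2)"
      using poincare[OF sum_f] unfolding norm_f by (subst sum.swap)
    also have "\<dots> \<le> C * (\<Sum>i<3::nat. 2 * real (card A))"
      using edge C_ge_1 by (intro mult_left_mono sum_mono) auto
    finally have 1: "a * b / real n \<le> 6 * C * real (card A)" by simp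
    have "min a b / 2 \<le> a * b / real n"
    proof -
      have "min a b * (a + b) \<le> 2 * (a * b)"
        using pos by (cases "a \<le> b") (auto simp: min_def algebra_simps)
      then show ?thesis using pos by (simp add: ab[symmetric] field_simps)
    qed
    with 1 have "min a b \<le> 12 * C * real (card A)" by linarith
    moreover have "min a b > 0" using pos by simp
    \<comment> \<open>Doubling the constant makes the inequality strict.\<close>
    ultimately have "min a b < 24 * C * real (card A)" by linarith
    then have "1 / (24 * C) < real (card A) / min a b"
      using C_ge_1 \<open>min a b > 0\<close> by (simp add: field_simps)
    then show ?thesis unfolding card_A a_def b_def by (simp add: of_nat_min)
  qed
  note bound = this
  have "{0} \<noteq> {..<n}" using n_ge_2 by (metis One_nat_def Suc_1 Suc_le_eq lessThan_iff n_not_Suc_n singletonD)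
  then have "{0} \<in> ?SS" using n_ge_2 by auto
  then have "?SS \<noteq> {}" by blast
  moreover have "finite ?SS" by (rule finite_subset[of _ "Pow {..<n}"]) auto
  ultimately show ?thesis
    unfolding cheeger_def pverts_G by (subst Min_gr_iff) (simp, simp, blast intro: bound)
qed

end

section \<open>The graph family\<close>

text \<open>
  Vertex \<open>8 * (x * m + y) + p\<close> is port \<open>p\<close> of the torus point \<open>(x, y)\<close>. The ports of a point
  form an 8-cycle; the even ports \<open>0, 2, 4, 6\<close> are joined to the ports \<open>3, 5, 7, 1\<close> of the
  images under the four torus generators. At the origin, the cycle is re-routed
  such that its ports \<open>0, 2, 3\<close> form a triangle; only the re-routed edges \<open>{0, 2}\<close> and \<open>{1, 7}\<close>
  join ports of equal parity.
\<close>

definition vertex :: "nat \<Rightarrow> nat \<Rightarrow> nat \<Rightarrow> nat \<Rightarrow> nat" where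
  "vertex m x y p = 8 * (x * m + y) + p"

text \<open>Inverse generators add \<open>m - y\<close>, \<open>m - x\<close> or
  \<open>m - 1\<close>, as subtraction of naturals truncates. The last branch is port 5.\<close>

definition torus_edge :: "nat \<Rightarrow> nat \<Rightarrow> nat \<Rightarrow> nat \<Rightarrow> nat" where
  "torus_edge m x y p =
    (if p = 0 then vertex m ((x + y) mod m) y 3
     else if p = 3 then vertex m ((x + (m - y)) mod m) y 0
     else if p = 6 then vertex m x ((x + y) mod m) 1
     else if p = 1 then vertex m x ((y + (m - x)) mod m) 6
     else if p = 4 then vertex m ((x + 1) mod m) y 7
     else if p = 7 then vertex m ((x + (m - 1)) mod m) y 4
     else if p = 2 then vertex m x ((y + 1) mod m) 5
     else vertex m x ((y + (m - 1)) mod m) 2)"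

definition swap_ports :: "nat \<Rightarrow> nat" where
  "swap_ports u = (if u mod 2 = 0 then u + 1 else u - 1)"

text \<open>With \<open>swap_ports\<close> this yields the cycle 0, 1, ..., 7 away from the origin
  and 0, 1, 7, 6, 5, 4, 3, 2 at the origin. The third side {0, 3} of the triangle is a torus edge,
  since shears fix the origin.\<close>

definition link_ports :: "nat \<Rightarrow> nat" where
  "link_ports u =
    (if u = 0 then 2 else if u = 2 then 0 else if u = 1 then 7 else if u = 7 then 1
     else if u mod 8 = 0 then u + 7 else if u mod 8 = 7 then u - 7
     else if u mod 2 = 0 then u - 1 else u + 1)"

definition matching :: "nat \<Rightarrow> nat \<Rightarrow> nat \<Rightarrow> nat" where
  "matching m i u =
    (if i = 0 then swap_ports u else if i = 1 then link_ports u
     else torus_edge m (u div (8 * m)) (u div 8 mod m) (u mod 8))"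

section \<open>The three matchings\<close>

lemma less_8_cases: "(p :: nat) < 8 \<longleftrightarrow> p = 0 \<or> p = 1 \<or> p = 2 \<or> p = 3 \<or> p = 4 \<or> p = 5 \<or> p = 6 \<or> p = 7"
  by auto

lemma lessThan_8: "{..<8 :: nat} = {0, 1, 2, 3, 4, 5, 6, 7}"
  by auto

lemma vertex_less:
  assumes "x < m" "y < m" "p < 8" shows "vertex m x y p < 8 * (m * m)"
proof -
  have "x * m + y < Suc x * m" using assms(2) by simp
  also have "\<dots> \<le> m * m" using assms(1) by (intro mult_le_mono1) simp
  finally show ?thesis using assms(3) by (simp add: vertex_def)
qed

lemma vertex_mod_8: "p < 8 \<Longrightarrow> vertex m x y p mod 8 = p"
  unfolding vertex_def by (simp only: mod_mult_self4 mod_less)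

lemma vertex_div_8: "p < 8 \<Longrightarrow> vertex m x y p div 8 = x * m + y"
  unfolding vertex_def by (subst div_mult_self4) simp_all

lemma vertex_div_mod:
  assumes "x < m" "y < m" "p < 8"
  shows "vertex m x y p div (8 * m) = x" "vertex m x y p div 8 mod m = y" "vertex m x y p mod 8 = p"
  using assms by (simp_all add: div_mult2_eq vertex_div_8 vertex_mod_8)

lemma vertex_cases:
  assumes "u < 8 * (m * m)"
  obtains x y p where "x < m" "y < m" "p < 8" "u = vertex m x y p"
proof
  have "m > 0" using assms by (cases m) auto
  have "u div 8 < m * m" using assms by (simp add: less_mult_imp_div_less mult.commute)
  then show "u div 8 div m < m" by (rule less_mult_imp_div_less)
  show "u div 8 mod m < m" "u mod 8 < 8" using \<open>m > 0\<close> by auto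
  show "u = vertex m (u div 8 div m) (u div 8 mod m) (u mod 8)"
    by (simp add: vertex_def)
qed

lemma matching_2_vertex:
  "x < m \<Longrightarrow> y < m \<Longrightarrow> p < 8 \<Longrightarrow> matching m 2 (vertex m x y p) = torus_edge m x y p"
  by (simp add: matching_def vertex_div_mod)

lemma matching_0 [simp]: "matching m 0 u = swap_ports u"
  by (simp add: matching_def)

lemma matching_1 [simp]: "matching m (Suc 0) u = link_ports u"
  by (simp add: matching_def)

lemma swap_ports_eqs:
  "swap_ports (8 * q) = 8 * q + 1" "swap_ports (8 * q + 1) = 8 * q"
  "swap_ports (8 * q + 2) = 8 * q + 3" "swap_ports (8 * q + 3) = 8 * q + 2"
  "swap_ports (8 * q + 4) = 8 * q + 5" "swap_ports (8 * q + 5) = 8 * q + 4"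
  "swap_ports (8 * q + 6) = 8 * q + 7" "swap_ports (8 * q + 7) = 8 * q + 6"
  unfolding swap_ports_def by presburger+

lemma link_ports_eqs:
  "link_ports (8 * q) = (if q = 0 then 2 else 8 * q + 7)"
  "link_ports (8 * q + 1) = (if q = 0 then 7 else 8 * q + 2)"
  "link_ports (8 * q + 2) = (if q = 0 then 0 else 8 * q + 1)"
  "link_ports (8 * q + 3) = 8 * q + 4" "link_ports (8 * q + 4) = 8 * q + 3"
  "link_ports (8 * q + 5) = 8 * q + 6" "link_ports (8 * q + 6) = 8 * q + 5"
  "link_ports (8 * q + 7) = (if q = 0 then 1 else 8 * q)"
proof -
  have m8: "(8 * q + k) mod 8 = k mod 8" for k by simp
  have m2: "(8 * q + k) mod 2 = k mod 2" for k by presburger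
  have neq: "8 * q + k \<noteq> 0" "8 * q + k \<noteq> 1" "8 * q + k \<noteq> 2" "8 * q + k \<noteq> 7" if "q \<noteq> 0" for k
    using that by linarith+
  have link: "link_ports (8 * q + k) = (if k mod 8 = 0 then 8 * q + k + 7
      else if k mod 8 = 7 then 8 * q + k - 7
      else if k mod 2 = 0 then 8 * q + k - 1 else 8 * q + k + 1)" if "q \<noteq> 0" for k
    unfolding link_ports_def m8 m2 using neq[OF that] by simp
  show "link_ports (8 * q) = (if q = 0 then 2 else 8 * q + 7)"
    using link[of 0] by (cases "q = 0") (simp_all add: link_ports_def)
  show "link_ports (8 * q + 1) = (if q = 0 then 7 else 8 * q + 2)"
    using link[of 1] by (cases "q = 0") (simp_all add: link_ports_def)
  show "link_ports (8 * q + 2) = (if q = 0 then 0 else 8 * q + 1)"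
    using link[of 2] by (cases "q = 0") (simp_all add: link_ports_def)
  show "link_ports (8 * q + 3) = 8 * q + 4" "link_ports (8 * q + 4) = 8 * q + 3"
    "link_ports (8 * q + 5) = 8 * q + 6" "link_ports (8 * q + 6) = 8 * q + 5"
    using link[of 3] link[of 4] link[of 5] link[of 6]
    by (cases "q = 0"; simp add: link_ports_def)+
  show "link_ports (8 * q + 7) = (if q = 0 then 1 else 8 * q)"
    using link[of 7] by (cases "q = 0") (simp_all add: link_ports_def)
qed

lemma port_cases:
  obtains q p :: nat where "u = 8 * q + p" "p < 8"
  by (metis mult_div_mod_eq mod_less_divisor zero_less_numeral)

lemma swap_ports_invol: "swap_ports (swap_ports u) = u"
proof -
  obtain q p where u: "u = 8 * q + p" "p < 8" by (rule port_cases)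
  show ?thesis
    using u(2) unfolding u(1) less_8_cases by (elim disjE) (simp_all only: swap_ports_eqs add_0_right)
qed

lemma link_ports_invol: "link_ports (link_ports u) = u"
proof -
  obtain q p where u: "u = 8 * q + p" "p < 8" by (rule port_cases)
  show ?thesis
  proof (cases "q = 0")
    case True
    then show ?thesis using u(2) unfolding u(1) less_8_cases
      by (elim disjE) (simp_all add: link_ports_def)
  next
    case False
    then show ?thesis using u(2) unfolding u(1) less_8_cases
      by (elim disjE) (simp_all only: link_ports_eqs add_0_right if_False)
  qed
qed

text \<open>Ports modulo 8 alone tell the matchings apart: cycle edges change the port by 1 or 7,
  re-routed ones by 2 or 6, torus edges by 3 or 5. So the graph is simple for every
  \<open>m\<close>, even where torus generators have fixed points.\<close>

lemma ports_mod_8: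
  assumes p: "p = u mod 8"
  shows "swap_ports u mod 8 \<noteq> p" "link_ports u mod 8 \<noteq> p" "swap_ports u mod 8 \<noteq> link_ports u mod 8"
    "swap_ports u mod 8 \<noteq> (if even p then (p + 3) mod 8 else (p + 5) mod 8)"
    "link_ports u mod 8 \<noteq> (if even p then (p + 3) mod 8 else (p + 5) mod 8)"
proof -
  obtain q p' where u: "u = 8 * q + p'" "p' < 8" by (rule port_cases)
  have "p' = p" using p u by simp
  note u = u[unfolded this]
  have m8: "(8 * q + k) mod 8 = k mod 8" "8 * q mod 8 = 0" for k by simp_all
  have "swap_ports u mod 8 \<noteq> p \<and> link_ports u mod 8 \<noteq> p \<and> swap_ports u mod 8 \<noteq> link_ports u mod 8
    \<and> swap_ports u mod 8 \<noteq> (if even p then (p + 3) mod 8 else (p + 5) mod 8)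
    \<and> link_ports u mod 8 \<noteq> (if even p then (p + 3) mod 8 else (p + 5) mod 8)"
  proof (cases "q = 0")
    case True
    then show ?thesis using u(2) unfolding u(1) less_8_cases
      by (elim disjE) (simp_all add: link_ports_def swap_ports_def)
  next
    case False
    then show ?thesis using u(2) unfolding u(1) less_8_cases
      by (elim disjE; simp only: link_ports_eqs swap_ports_eqs add_0_right if_False m8; simp)
  qed
  then show "swap_ports u mod 8 \<noteq> p" "link_ports u mod 8 \<noteq> p" "swap_ports u mod 8 \<noteq> link_ports u mod 8"
    "swap_ports u mod 8 \<noteq> (if even p then (p + 3) mod 8 else (p + 5) mod 8)"
    "link_ports u mod 8 \<noteq> (if even p then (p + 3) mod 8 else (p + 5) mod 8)" by blast+
qed

text \<open>Each generator undoes its inverse. Allowing \<open>y = m\<close> covers the unit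
  translation for \<open>m = 1\<close>.\<close>

lemma mod_add_sub_cancel:
  assumes "x < m" "y \<le> m"
  shows "((x + y) mod m + m - y) mod m = (x::nat)" "((x + m - y) mod m + y) mod m = x"
    "((y + x) mod m + m - y) mod m = x" "(y + (x + m - y) mod m) mod m = x"
proof -
  have "x + y + (m - y) = x + m" "x + (m - y) + y = x + m"
    "y + x + (m - y) = x + m" "y + (x + (m - y)) = x + m" using assms(2) by simp_all
  then have "((x + y) mod m + (m - y)) mod m = x" "((x + (m - y)) mod m + y) mod m = x"
    "((y + x) mod m + (m - y)) mod m = x" "(y + (x + (m - y)) mod m) mod m = x"
    using assms(1) by (simp_all only: mod_add_left_eq mod_add_right_eq mod_add_self2 mod_less)
  then show "((x + y) mod m + m - y) mod m = x" "((x + m - y) mod m + y) mod m = x"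
    "((y + x) mod m + m - y) mod m = x" "(y + (x + m - y) mod m) mod m = x"
    using assms(2) by simp_all
qed

lemma torus_edge_mod_8: "p < 8 \<Longrightarrow> torus_edge m x y p mod 8 = (if even p then (p + 3) mod 8 else (p + 5) mod 8)"
  unfolding less_8_cases by (auto simp: torus_edge_def vertex_mod_8)

lemma matching_less:
  assumes "i < 3" "u < 8 * (m * m)" shows "matching m i u < 8 * (m * m)"
proof -
  obtain x y p where u: "x < m" "y < m" "p < 8" "u = vertex m x y p" using vertex_cases[OF assms(2)] .
  define q where "q = x * m + y"
  have m: "m > 0" using u by simp
  have q: "8 * q + 7 < 8 * (m * m)" using vertex_less[of x m y 7] u by (simp add: vertex_def q_def)
  have u': "u = 8 * q + p" using u by (simp add: vertex_def q_def)
  consider "i = 0" | "i = 1" | "i = 2" using assms(1) by linarith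
  then show ?thesis
  proof cases
    case 1
    have "swap_ports u < 8 * (m * m)"
      using u(3) q unfolding u' less_8_cases
      by (elim disjE; simp only: swap_ports_eqs add_0_right; linarith)
    then show ?thesis using 1 by simp
  next
    case 2
    have "link_ports u < 8 * (m * m)"
      using u(3) q unfolding u' less_8_cases
      by (elim disjE; simp only: link_ports_eqs add_0_right split: if_split; linarith)
    then show ?thesis using 2 by simp
  next
    case 3
    then show ?thesis using u m
      by (simp add: matching_2_vertex) (auto simp: torus_edge_def intro!: vertex_less)
  qed
qed

lemma matching_invol:
  assumes "i < 3" "u < 8 * (m * m)" shows "matching m i (matching m i u) = u"
proof -
  obtain x y p where u: "x < m" "y < m" "p < 8" "u = vertex m x y p" using vertex_cases[OF assms(2)] .
  have m: "m > 0" using u by simp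
  consider "i = 0" | "i = 1" | "i = 2" using assms(1) by linarith
  then show ?thesis
  proof cases
    case 1
    then show ?thesis by (simp add: swap_ports_invol)
  next
    case 2
    then show ?thesis by (simp add: link_ports_invol)
  next
    case 3
    have "matching m 2 (torus_edge m x y p) = vertex m x y p"
      using u(3) m u(1,2) unfolding less_8_cases
      by (elim disjE) (simp_all add: torus_edge_def matching_2_vertex mod_add_sub_cancel del: One_nat_def)
    then show ?thesis using u 3 by (simp add: matching_2_vertex)
  qed
qed

lemma matching_2_mod_8:
  assumes "u < 8 * (m * m)" "p = u mod 8"
  shows "matching m 2 u mod 8 = (if even p then (p + 3) mod 8 else (p + 5) mod 8)"
proof -
  obtain x y p' where u: "x < m" "y < m" "p' < 8" "u = vertex m x y p'" using vertex_cases[OF assms(1)] .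
  moreover have "p = p'" using u assms(2) by (simp add: vertex_mod_8)
  ultimately show ?thesis by (simp add: matching_2_vertex torus_edge_mod_8)
qed

lemma matching_neq:
  assumes "i < 3" "u < 8 * (m * m)" shows "matching m i u \<noteq> u"
proof -
  have "matching m 2 u mod 8 \<noteq> u mod 8"
  proof -
    have "u mod 8 < 8" by simp
    then show ?thesis
      unfolding matching_2_mod_8[OF assms(2) refl] less_8_cases by (elim disjE) simp_all
  qed
  moreover have "i = 0 \<or> i = 1 \<or> i = 2" using assms(1) by linarith
  ultimately show ?thesis using ports_mod_8(1,2)[OF refl, of u] by auto
qed

lemma matching_inj:
  assumes "i < 3" "j < 3" "u < 8 * (m * m)" "matching m i u = matching m j u" shows "i = j"
proof -
  have "swap_ports u mod 8 \<noteq> matching m 2 u mod 8" "link_ports u mod 8 \<noteq> matching m 2 u mod 8"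
    unfolding matching_2_mod_8[OF assms(3) refl] by (rule ports_mod_8[OF refl])+
  moreover have "i = 0 \<or> i = 1 \<or> i = 2" "j = 0 \<or> j = 1 \<or> j = 2" using assms(1,2) by linarith+
  ultimately show ?thesis using assms(4) ports_mod_8(3)[OF refl, of u] by auto
qed

section \<open>Poincare inequality for the cubic graphs\<close>

lemma sum_blocks:
  fixes g :: "nat \<Rightarrow> real"
  shows "(\<Sum>u<a * b. g u) = (\<Sum>i<a. \<Sum>j<b. g (i * b + j))"
proof -
  have "(\<Sum>u<a * b. g u) = (\<Sum>i<a. sum g {i * b..<i * b + b})"
    by (rule sum.nat_group[symmetric])
  also have "\<dots> = (\<Sum>i<a. \<Sum>j<b. g (i * b + j))"
  proof (rule sum.cong[OF refl])
    fix i
    show "sum g {i * b..<i * b + b} = (\<Sum>j<b. g (i * b + j))"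
      using sum.shift_bounds_nat_ivl[of g 0 "i * b" b] by (simp add: atLeast0LessThan add.commute)
  qed
  finally show ?thesis .
qed

lemma sum_vertex:
  fixes g :: "nat \<Rightarrow> real"
  shows "(\<Sum>u<8 * (m * m). g u) = (\<Sum>x<m. \<Sum>y<m. \<Sum>p<8. g (vertex m x y p))"
proof -
  have "(\<Sum>u<8 * (m * m). g u) = (\<Sum>q<m * m. \<Sum>p<8. g (q * 8 + p))"
    using sum_blocks[of g "m * m" 8] by (simp add: mult.commute)
  then show ?thesis
    using sum_blocks[of "\<lambda>q. \<Sum>p<8. g (q * 8 + p)" m m] by (simp add: vertex_def mult.commute)
qed

lemma square_le_of_abs_le: "\<bar>a\<bar> \<le> c \<Longrightarrow> a\<^sup>2 \<le> (c :: real)\<^sup>2"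
  by (rule abs_le_square_iff[THEN iffD1]) linarith

text \<open>Transfer from the torus: port 0 represents its block, the other ports are reached along
  the cycle, and a torus generator becomes a path through two blocks.\<close>

lemma matching_poincare:
  fixes F :: "nat \<Rightarrow> real"
  assumes m: "m > 0" and mean: "(\<Sum>u<8 * (m * m). F u) = 0"
  shows "(\<Sum>u<8 * (m * m). (F u)\<^sup>2)
    \<le> 10 ^ 6 * (\<Sum>u<8 * (m * m). \<Sum>i<3. (F u - F (matching m i u))\<^sup>2)"
proof -
  define D where "D u = (\<Sum>i<3. (F u - F (matching m i u))\<^sup>2)" for u
  \<comment> \<open>The energy at the eight ports of a point; its root \<open>r\<close> bounds the
    difference along every single edge there.\<close>
  define d where "d x y = (\<Sum>p<8. D (vertex m x y p))" for x y
  define r where "r x y = sqrt (d x y)" for x y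
  define tot where "tot = (\<Sum>u<8 * (m * m). D u)"
  have D0: "D u \<ge> 0" for u by (simp add: D_def sum_nonneg)
  have d0: "d x y \<ge> 0" for x y by (simp add: d_def D0 sum_nonneg)
  have r2: "(r x y)\<^sup>2 = d x y" for x y by (simp add: r_def d0)
  have r0: "r x y \<ge> 0" for x y by (simp add: r_def d0)
  have tot: "tot = (\<Sum>x<m. \<Sum>y<m. d x y)" unfolding tot_def d_def by (rule sum_vertex)
  have tot0: "tot \<ge> 0" unfolding tot by (simp add: d0 sum_nonneg)
  have edge: "\<bar>F (vertex m x y p) - F (matching m i (vertex m x y p))\<bar> \<le> r x y" if "p < 8" "i < 3" for x y p i
  proof -
    have "(F (vertex m x y p) - F (matching m i (vertex m x y p)))\<^sup>2 \<le> D (vertex m x y p)"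
      unfolding D_def
      by (rule member_le_sum[of i "{..<3}" "\<lambda>i. (F (vertex m x y p) - F (matching m i (vertex m x y p)))\<^sup>2"])
        (use that in auto)
    also have "\<dots> \<le> d x y"
      unfolding d_def by (rule member_le_sum[of p "{..<8}" "\<lambda>p. D (vertex m x y p)"]) (use that D0 in auto)
    finally show ?thesis unfolding r_def by (intro real_le_rsqrt) simp
  qed
  have path: "\<bar>F (vertex m x y p) - F (vertex m x y 0)\<bar> \<le> 7 * r x y" if p: "p < 8" for x y p
  proof -
    define q where "q = x * m + y"
    have s: "\<bar>F (8 * q + k) - F (matching m i (8 * q + k))\<bar> \<le> r x y" if "k < 8" "i < 3" for k i
      using edge[OF that, of x y] by (simp add: vertex_def q_def)
    have e01: "\<bar>F (8 * q) - F (8 * q + 1)\<bar> \<le> r x y" and e23: "\<bar>F (8 * q + 2) - F (8 * q + 3)\<bar> \<le> r x y"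
      and e45: "\<bar>F (8 * q + 4) - F (8 * q + 5)\<bar> \<le> r x y" and e67: "\<bar>F (8 * q + 6) - F (8 * q + 7)\<bar> \<le> r x y"
      using s[of 0 0] s[of 2 0] s[of 4 0] s[of 6 0] unfolding matching_0 swap_ports_eqs add_0_right
      by simp_all
    have e34: "\<bar>F (8 * q + 3) - F (8 * q + 4)\<bar> \<le> r x y" and e56: "\<bar>F (8 * q + 5) - F (8 * q + 6)\<bar> \<le> r x y"
      using s[of 3 "Suc 0"] s[of 5 "Suc 0"] unfolding matching_1 link_ports_eqs by simp_all
    \<comment> \<open>At the origin the edge {1, 2} is missing, but {0, 2} is present; either way
      port 2 is within two steps of port 0.\<close>
    have e2: "\<bar>F (8 * q + 1) - F (8 * q + 2)\<bar> \<le> r x y \<or> \<bar>F (8 * q) - F (8 * q + 2)\<bar> \<le> r x y"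
      using s[of 1 "Suc 0"] s[of 0 "Suc 0"] unfolding matching_1 link_ports_eqs add_0_right
      by (cases "q = 0") (simp_all add: numeral_2_eq_2)
    have b2: "\<bar>F (8 * q + 2) - F (8 * q)\<bar> \<le> 2 * r x y" using e2 e01 by linarith
    have b3: "\<bar>F (8 * q + 3) - F (8 * q)\<bar> \<le> 3 * r x y" using b2 e23 by linarith
    have b4: "\<bar>F (8 * q + 4) - F (8 * q)\<bar> \<le> 4 * r x y" using b3 e34 by linarith
    have b5: "\<bar>F (8 * q + 5) - F (8 * q)\<bar> \<le> 5 * r x y" using b4 e45 by linarith
    have b6: "\<bar>F (8 * q + 6) - F (8 * q)\<bar> \<le> 6 * r x y" using b5 e56 by linarith
    have b7: "\<bar>F (8 * q + 7) - F (8 * q)\<bar> \<le> 7 * r x y" using b6 e67 by linarith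
    have "\<bar>F (8 * q + k) - F (8 * q)\<bar> \<le> 7 * r x y" if "\<bar>F (8 * q + k) - F (8 * q)\<bar> \<le> c * r x y" "c \<le> 7" for k c
      using that r0[of x y] mult_right_mono[of c 7 "r x y"] by linarith
    note le_7 = this
    have "\<bar>F (8 * q + 1) - F (8 * q)\<bar> \<le> 1 * r x y" "\<bar>F (8 * q + 0) - F (8 * q)\<bar> \<le> 0 * r x y"
      using e01 by (simp_all add: abs_minus_commute)
    note this[THEN le_7] b2[THEN le_7] b3[THEN le_7] b4[THEN le_7] b5[THEN le_7] b6[THEN le_7] b7
    then have "\<bar>F (8 * q + p) - F (8 * q)\<bar> \<le> 7 * r x y"
      using p unfolding less_8_cases by (elim disjE) simp_all
    then show ?thesis by (simp add: vertex_def q_def)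
  qed
  define \<mu> where "\<mu> = (\<Sum>x<m. \<Sum>y<m. F (vertex m x y 0)) / real (m * m)"
  define g where "g x y = F (vertex m x y 0) - \<mu>" for x y
  have mean_g: "(\<Sum>x<m. \<Sum>y<m. g x y) = 0"
    using m by (simp add: g_def \<mu>_def sum_subtractf)
  \<comment> \<open>The path from port 0 to port 0 of the image costs \<open>7 * r\<close> to reach
    \<open>p\<close>, one \<open>r\<close> for the torus edge and 7 times the \<open>r\<close> of
    the image from \<open>p'\<close>: at most 8 times the sum of both.\<close>
  have shift: "shift_energy m g (\<lambda>x y. g (a x y) (b x y)) \<le> 256 * tot"
    if ab: "\<And>x y. x < m \<Longrightarrow> y < m \<Longrightarrow> matching m 2 (vertex m x y p) = vertex m (a x y) (b x y) p'"
      and p: "p < 8" "p' < 8"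
      and sum: "(\<Sum>x<m. \<Sum>y<m. d (a x y) (b x y)) = (\<Sum>x<m. \<Sum>y<m. d x y)" for a b p p'
  proof -
    have "(g (a x y) (b x y) - g x y)\<^sup>2 \<le> 128 * (d x y + d (a x y) (b x y))" if "x < m" "y < m" for x y
    proof -
      have "\<bar>F (vertex m x y p) - F (vertex m (a x y) (b x y) p')\<bar> \<le> r x y"
        using edge[OF p(1), of 2 x y] ab[OF that] by simp
      then have "\<bar>g (a x y) (b x y) - g x y\<bar> \<le> 8 * (r x y + r (a x y) (b x y))"
        using path[OF p(1), of x y] path[OF p(2), of "a x y" "b x y"] r0[of "a x y" "b x y"]
        unfolding g_def abs_le_iff by argo
      then have "(g (a x y) (b x y) - g x y)\<^sup>2 \<le> (8 * (r x y + r (a x y) (b x y)))\<^sup>2"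
        by (rule square_le_of_abs_le)
      also have "\<dots> \<le> 128 * ((r x y)\<^sup>2 + (r (a x y) (b x y))\<^sup>2)"
        using sum_squares_bound[of "r x y" "r (a x y) (b x y)"]
        by (simp add: power2_eq_square algebra_simps)
      finally show ?thesis by (simp add: r2)
    qed
    then have "shift_energy m g (\<lambda>x y. g (a x y) (b x y))
        \<le> (\<Sum>x<m. \<Sum>y<m. 128 * (d x y + d (a x y) (b x y)))"
      unfolding shift_energy_def by (intro sum_mono) auto
    also have "\<dots> = 128 * (tot + tot)"
      by (simp only: sum_distrib_left[symmetric] sum.distrib sum tot)
    finally show ?thesis by simp
  qed
  have sum3: "(\<Sum>x<m. \<Sum>y<m. d ((x + 1) mod m) y) = (\<Sum>x<m. \<Sum>y<m. d x y)"
    by (rule sum.reindex_bij_betw[OF bij_betw_shift_mod[OF m, of 1], of "\<lambda>x. \<Sum>y<m. d x y"])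
  have sum4: "(\<Sum>x<m. \<Sum>y<m. d x ((y + 1) mod m)) = (\<Sum>x<m. \<Sum>y<m. d x y)"
    by (intro sum.cong refl sum.reindex_bij_betw[OF bij_betw_shift_mod[OF m, of 1]])
  have "(\<Sum>x<m. \<Sum>y<m. (g x y)\<^sup>2) \<le> 32 *
    (shift_energy m g (\<lambda>x y. g ((x + y) mod m) y) + shift_energy m g (\<lambda>x y. g x ((x + y) mod m))
     + shift_energy m g (\<lambda>x y. g ((x + 1) mod m) y) + shift_energy m g (\<lambda>x y. g x ((y + 1) mod m)))"
    by (rule torus_poincare[OF m mean_g])
  also have "\<dots> \<le> 32 * (256 * tot + 256 * tot + 256 * tot + 256 * tot)"
  proof (intro mult_left_mono add_mono)
    show "shift_energy m g (\<lambda>x y. g ((x + y) mod m) y) \<le> 256 * tot"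
      by (rule shift[of 0 _ _ 3]) (simp_all add: matching_2_vertex torus_edge_def sum_shear1[OF m])
    show "shift_energy m g (\<lambda>x y. g x ((x + y) mod m)) \<le> 256 * tot"
      by (rule shift[of 6 _ _ 1]) (simp_all add: matching_2_vertex torus_edge_def sum_shear2[OF m])
    show "shift_energy m g (\<lambda>x y. g ((x + 1) mod m) y) \<le> 256 * tot"
      by (rule shift[of 4 _ _ 7]) (simp_all add: matching_2_vertex torus_edge_def sum3[simplified])
    show "shift_energy m g (\<lambda>x y. g x ((y + 1) mod m)) \<le> 256 * tot"
      by (rule shift[of 2 _ _ 5]) (simp_all add: matching_2_vertex torus_edge_def sum4[simplified])
  qed simp
  finally have sum_g: "(\<Sum>x<m. \<Sum>y<m. (g x y)\<^sup>2) \<le> 32768 * tot" by simp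
  \<comment> \<open>Subtracting a constant from a mean-zero function can only increase the sum of
    squares; \<open>\<mu>\<close> is the mean over port 0, in general not that of
    \<open>F\<close>.\<close>
  have "(\<Sum>u<8 * (m * m). (F u)\<^sup>2) \<le> (\<Sum>u<8 * (m * m). (F u - \<mu>)\<^sup>2)"
  proof -
    have "(\<Sum>u<8 * (m * m). (F u - \<mu>)\<^sup>2) = (\<Sum>u<8 * (m * m). (F u)\<^sup>2 - 2 * \<mu> * F u + \<mu>\<^sup>2)"
      by (intro sum.cong refl) (simp add: power2_eq_square algebra_simps)
    also have "\<dots> = (\<Sum>u<8 * (m * m). (F u)\<^sup>2) - 2 * \<mu> * (\<Sum>u<8 * (m * m). F u) + 8 * (m * m) * \<mu>\<^sup>2"
      by (simp add: sum.distrib sum_subtractf sum_distrib_left)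
    finally show ?thesis using mean by simp
  qed
  also have "\<dots> = (\<Sum>x<m. \<Sum>y<m. \<Sum>p<8. (F (vertex m x y p) - \<mu>)\<^sup>2)" by (rule sum_vertex)
  also have "\<dots> \<le> (\<Sum>x<m. \<Sum>y<m. \<Sum>p<8::nat. 2 * (g x y)\<^sup>2 + 98 * d x y)"
  proof (intro sum_mono)
    fix x y p :: nat assume "p \<in> {..<8}"
    then have "\<bar>F (vertex m x y p) - F (vertex m x y 0)\<bar> \<le> 7 * r x y" using path by simp
    then have "(F (vertex m x y p) - F (vertex m x y 0))\<^sup>2 \<le> (7 * r x y)\<^sup>2" by (rule square_le_of_abs_le)
    then have 1: "(F (vertex m x y p) - F (vertex m x y 0))\<^sup>2 \<le> 49 * d x y"
      by (simp add: power_mult_distrib r2)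
    have "(s + t)\<^sup>2 \<le> 2 * s\<^sup>2 + 2 * t\<^sup>2" for s t :: real
      using sum_squares_bound[of s t] by (simp add: power2_sum)
    from this[of "F (vertex m x y p) - F (vertex m x y 0)" "g x y"] 1
    show "(F (vertex m x y p) - \<mu>)\<^sup>2 \<le> 2 * (g x y)\<^sup>2 + 98 * d x y"
      by (simp add: g_def)
  qed
  also have "\<dots> = 16 * (\<Sum>x<m. \<Sum>y<m. (g x y)\<^sup>2) + 784 * tot"
    unfolding tot by (simp add: sum.distrib sum_distrib_left)
  \<comment> \<open>16 * 32768 + 784 = 525072.\<close>
  also have "\<dots> \<le> 10 ^ 6 * tot" using sum_g tot0 by simp
  finally show ?thesis unfolding tot_def D_def .
qed

lemma cubic_matching: "m > 0 \<Longrightarrow> cubic_graph (8 * (m * m)) (matching m) (10 ^ 6)"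
proof
  assume m: "m > 0"
  then have "m * m > 0" by simp
  then show "2 \<le> 8 * (m * m)" "3 < 8 * (m * m)" by linarith+
  show "matching m 0 2 = 3" "matching m 1 0 = 2" by (simp_all add: swap_ports_def link_ports_def)
  show "matching m 2 3 = 0" using m by (simp add: matching_def torus_edge_def vertex_def)
qed (assumption | rule matching_less matching_invol matching_neq matching_inj matching_poincare | simp)+

section \<open>Parity of the ports\<close>

definition parity_sign :: "nat \<Rightarrow> real" where
  "parity_sign u = (if even u then 1 else - 1)"

lemma sum_parity_sign: "(\<Sum>u<8 * (m * m). parity_sign u) = 0"
  unfolding sum_vertex by (simp add: parity_sign_def vertex_def lessThan_8)

lemma matching_parity:
  assumes "i < 3" "u < 8 * (m * m)" "i \<noteq> 1 \<or> u \<notin> {0, 1, 2, 7}"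
  shows "even (matching m i u) \<longleftrightarrow> odd u"
proof -
  have "even (swap_ports u) \<longleftrightarrow> odd u" unfolding swap_ports_def by presburger
  moreover have "even (link_ports u) \<longleftrightarrow> odd u" if "u \<notin> {0, 1, 2, 7}"
  proof -
    obtain q p where u: "u = 8 * q + p" "p < 8" by (rule port_cases)
    show ?thesis using that u(2) unfolding u(1) less_8_cases
      by (elim disjE; simp only: link_ports_eqs add_0_right split: if_split; auto)
  qed
  moreover have "even (matching m 2 u) \<longleftrightarrow> odd u"
  proof -
    have "even (matching m 2 u) \<longleftrightarrow> even (matching m 2 u mod 8)" by (simp add: dvd_mod_iff)
    also have "\<dots> \<longleftrightarrow> odd (u mod 8)"
    proof -
      have "u mod 8 < 8" by simp
      then show ?thesis
        unfolding matching_2_mod_8[OF assms(2) refl] less_8_cases by (elim disjE) simp_all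
    qed
    also have "\<dots> \<longleftrightarrow> odd u" by (simp add: dvd_mod_iff)
    finally show ?thesis .
  qed
  moreover have "i = 0 \<or> i = 1 \<or> i = 2" using assms(1) by linarith
  ultimately show ?thesis using assms(3) by auto
qed

text \<open>Only the re-routed edges {0, 2} and {1, 7} preserve parity. Each of their four ends has
  one such edge out of three and contributes at most 2/3, in total 8/3.\<close>

lemma parity_defect:
  assumes "m > 0"
  shows "(\<Sum>u<8 * (m * m). \<bar>cubic_graph.P (matching m) parity_sign u + parity_sign u\<bar>) \<le> 3"
proof -
  interpret cubic_graph "8 * (m * m)" "matching m" "10 ^ 6" using assms by (rule cubic_matching)
  have "\<bar>P parity_sign u + parity_sign u\<bar> \<le> 2 / 3 * of_bool (u \<in> {0, 1, 2, 7})"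
    if u: "u < 8 * (m * m)" for u
  proof -
    have flip: "parity_sign (matching m i u) = - parity_sign u"
      if "i < 3" "i \<noteq> 1 \<or> u \<notin> {0, 1, 2, 7}" for i
      using matching_parity[OF that(1) u that(2)] by (simp add: parity_sign_def)
    have "\<bar>P parity_sign u + parity_sign u\<bar> = \<bar>parity_sign (matching m 1 u) + parity_sign u\<bar> / 3"
    proof -
      have "P parity_sign u
          = (parity_sign (matching m 0 u) + parity_sign (matching m 1 u) + parity_sign (matching m 2 u)) / 3"
        by (simp add: P_def eval_nat_numeral)
      moreover have "parity_sign (matching m 0 u) = - parity_sign u" by (rule flip) simp_all
      moreover have "parity_sign (matching m 2 u) = - parity_sign u" by (rule flip) simp_all
      ultimately have "P parity_sign u + parity_sign u = (parity_sign (matching m 1 u) + parity_sign u) / 3"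
        by argo
      then show ?thesis by (simp only: abs_divide abs_numeral)
    qed
    moreover have "parity_sign (matching m 1 u) + parity_sign u = 0" if "u \<notin> {0, 1, 2, 7}"
      using flip[of 1] that by simp
    moreover have "\<bar>parity_sign (matching m 1 u) + parity_sign u\<bar> \<le> 2" by (simp add: parity_sign_def)
    ultimately show ?thesis by (cases "u \<in> {0, 1, 2, 7}") simp_all
  qed
  then have "(\<Sum>u<8 * (m * m). \<bar>P parity_sign u + parity_sign u\<bar>)
      \<le> (\<Sum>u<8 * (m * m). 2 / 3 * of_bool (u \<in> {0, 1, 2, 7}))"
    by (intro sum_mono) auto
  also have "\<dots> = 2 / 3 * real (card ({..<8 * (m * m)} \<inter> {0, 1, 2, 7}))"
    by (simp only: sum_distrib_left[symmetric] sum_of_bool_eq finite_lessThan Collect_mem_eq)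
  also have "\<dots> \<le> 2 / 3 * real (card {0, 1, 2, 7 :: nat})"
    by (intro mult_left_mono of_nat_mono card_mono) auto
  also have "\<dots> \<le> 3" by simp
  finally show ?thesis .
qed

section \<open>The family and the failure of cutoff\<close>

definition graph_family :: "nat \<Rightarrow> nat pair_pre_digraph" where
  "graph_family k = cubic_graph.G (8 * (Suc k * Suc k)) (matching (Suc k))"

lemma cubic_family: "cubic_graph (8 * (Suc k * Suc k)) (matching (Suc k)) (10 ^ 6)"
  by (rule cubic_matching) simp

text \<open>Unfolded, the matchings consist of arithmetic, comparisons and case distinctions on
  vertex numbers, to which the closure rules \<open>rec_intros\<close> apply.\<close>

lemma explicit_graph_family: "explicit_family graph_family"
proof -
  define N where "N = (\<lambda>xs :: nat list. 8 * (Suc (xs ! 0) * Suc (xs ! 0)))"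
  define A where "A = (\<lambda>xs :: nat list. of_bool (xs ! 2 = matching (Suc (xs ! 0)) 0 (xs ! 1)
    \<or> xs ! 2 = matching (Suc (xs ! 0)) 1 (xs ! 1) \<or> xs ! 2 = matching (Suc (xs ! 0)) 2 (xs ! 1)) :: nat)"
  have "recursive_fun 1 N"
    unfolding N_def by (intro rec_intros recursive_fun.proj; simp)
  moreover have "recursive_fun 3 A"
    unfolding A_def matching_def swap_ports_def link_ports_def torus_edge_def vertex_def by (intro rec_intros recursive_fun.proj; simp)
  moreover have "\<forall>k. pverts (graph_family k) = {..<N [k]} \<and>
      parcs (graph_family k) = {(u, v). u < N [k] \<and> v < N [k] \<and> A [k, u, v] = 1}"
  proof
    fix k
    interpret cubic_graph "8 * (Suc k * Suc k)" "matching (Suc k)" "10 ^ 6" by (rule cubic_family)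
    have ex3: "(\<exists>i<3. p i) \<longleftrightarrow> p 0 \<or> p 1 \<or> p 2" for p :: "nat \<Rightarrow> bool"
      by (auto simp: numeral_3_eq_3 numeral_2_eq_2 less_Suc_eq)
    have N: "N [k] = 8 * (Suc k * Suc k)" by (simp add: N_def)
    have A: "A [k, u, v] = 1 \<longleftrightarrow> v = matching (Suc k) 0 u \<or> v = matching (Suc k) 1 u \<or> v = matching (Suc k) 2 u" for u v
      by (simp add: A_def)
    have "(u, v) \<in> parcs G \<longleftrightarrow> u < N [k] \<and> v < N [k] \<and> A [k, u, v] = 1" for u v
      using \<sigma>_less[of 0 u] \<sigma>_less[of 1 u] \<sigma>_less[of 2 u]
      unfolding parcs_G mem_Collect_eq case_prod_conv ex3 N A by fastforce
    moreover have "pverts G = {..<N [k]}" unfolding N by (rule pverts_G)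
    ultimately show "pverts (graph_family k) = {..<N [k]} \<and>
      parcs (graph_family k) = {(u, v). u < N [k] \<and> v < N [k] \<and> A [k, u, v] = 1}"
      unfolding graph_family_def by blast
  qed
  ultimately show ?thesis unfolding explicit_family_def by blast
qed

lemma not_cutoff_graph_family:
  "\<not> tv_cutoff (\<lambda>k. pverts (graph_family k)) (\<lambda>k. srw (graph_family k))"
proof
  assume cutoff: "tv_cutoff (\<lambda>k. pverts (graph_family k)) (\<lambda>k. srw (graph_family k))"
  define a where "a k = real (t_mix (pverts (graph_family k)) (srw (graph_family k)) (1 / 5))" for k
  define b where "b k = real (t_mix (pverts (graph_family k)) (srw (graph_family k)) (4 / 5))" for k
  \<comment> \<open>The factor is 8 * (1 - 2/5) / 3, where 3 bounds the parity defect.\<close>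
  have lower: "8 / 5 * (real (Suc k))\<^sup>2 < a k" for k
  proof -
    interpret cubic_graph "8 * (Suc k * Suc k)" "matching (Suc k)" "10 ^ 6" by (rule cubic_family)
    have a: "a k = real (t_mix {..<8 * (Suc k * Suc k)} (srw G) (1 / 5))"
      unfolding a_def graph_family_def pverts_G ..
    have "real (8 * (Suc k * Suc k)) * (1 - 2 * (1 / 5))
      < a k * (\<Sum>u<8 * (Suc k * Suc k). \<bar>P parity_sign u + parity_sign u\<bar>)"
      unfolding a by (rule t_mix_lower[OF _ sum_parity_sign]) (simp_all add: parity_sign_def)
    also have "\<dots> \<le> a k * 3"
      by (intro mult_left_mono parity_defect) (simp_all add: a_def)
    finally have "real (8 * (Suc k * Suc k)) * (1 - 2 * (1 / 5)) < a k * 3" .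
    moreover have "real (8 * (Suc k * Suc k)) = 8 * (real (Suc k))\<^sup>2"
      by (simp add: power2_eq_square algebra_simps)
    ultimately show ?thesis by argo
  qed
  \<comment> \<open>The time \<open>Suc k\<close> is a convenient substitute for a multiple of the
    logarithm: the geometric decay beats the polynomial for large \<open>k\<close>, and
    \<open>Suc k\<close> is still of smaller order than its square.\<close>
  have upper: "b k \<le> real (Suc k)" if "(1 - 1 / (12 * 10 ^ 6)) ^ Suc k \<le> 1 / (8 * (real (Suc k))\<^sup>2)" for k
  proof -
    interpret cubic_graph "8 * (Suc k * Suc k)" "matching (Suc k)" "10 ^ 6" by (rule cubic_family)
    have "real (8 * (Suc k * Suc k)) = 8 * (real (Suc k))\<^sup>2"
      by (simp add: power2_eq_square algebra_simps)
    then have "t_mix {..<8 * (Suc k * Suc k)} (srw G) (4 / 5) \<le> Suc k"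
      using that by (intro t_mix_upper) simp_all
    then show ?thesis unfolding b_def graph_family_def pverts_G by simp
  qed
  have "(\<lambda>k. a k / b k) \<longlonglongrightarrow> 1"
    using cutoff[unfolded tv_cutoff_def, rule_format, of "1 / 5"] by (simp add: a_def b_def)
  then have "eventually (\<lambda>k. dist (a k / b k) 1 < 1 / 2) sequentially"
    by (rule tendstoD) simp
  moreover have "eventually (\<lambda>k. (1 - 1 / (12 * 10 ^ 6)) ^ Suc k \<le> 1 / (8 * (real (Suc k))\<^sup>2)) sequentially"
    by real_asymp
  ultimately have "eventually (\<lambda>k. False) sequentially"
  proof eventually_elim
    case (elim k)
    have "b k \<ge> 0" by (simp add: b_def)
    have ratio: "1 / 2 < a k / b k" "a k / b k < 3 / 2"
      using elim(1) unfolding dist_real_def by linarith+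
    \<comment> \<open>If \<open>b k\<close> were 0, the quotient would be 0 by convention, which the
      lower bound 1/2 excludes.\<close>
    then have "b k > 0" using \<open>b k \<ge> 0\<close> by (cases "b k = 0") auto
    then have "a k < 3 / 2 * b k" using ratio by (simp add: field_simps)
    also have "\<dots> \<le> 3 / 2 * real (Suc k)" using upper[OF elim(2)] by simp
    also have "\<dots> \<le> 8 / 5 * (real (Suc k))\<^sup>2"
      using self_le_power[of "real (Suc k)" 2] by simp
    finally show ?case using lower[of k] by linarith
  qed
  then show False by simp
qed

theorem mainTheorem3:
  shows "\<exists>G :: nat \<Rightarrow> nat pair_pre_digraph.
    explicit_family G \<and>
    (\<forall>k. regular_graph 3 (G k)) \<and>
    filterlim (\<lambda>k. card (pverts (G k))) at_top sequentially \<and>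
    expander_family G \<and>
    (\<forall>k. irreducible_chain (pverts (G k)) (srw (G k)) \<and>
         aperiodic_chain (pverts (G k)) (srw (G k))) \<and>
    \<not> tv_cutoff (\<lambda>k. pverts (G k)) (\<lambda>k. srw (G k))"
proof (intro exI[of _ graph_family] conjI allI)
  have verts: "pverts (graph_family k) = {..<8 * (Suc k * Suc k)}" for k
    unfolding graph_family_def by (rule cubic_graph.pverts_G[OF cubic_family])
  show "explicit_family graph_family" by (rule explicit_graph_family)
  show "regular_graph 3 (graph_family k)" for k
    unfolding graph_family_def by (rule cubic_graph.regular_graph_G[OF cubic_family])
  have "k \<le> card (pverts (graph_family k))" for k by (simp add: verts)
  then show "filterlim (\<lambda>k. card (pverts (graph_family k))) at_top sequentially"
    by (intro filterlim_at_top_mono[OF filterlim_ident]) auto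
  have "cheeger (graph_family k) > 1 / (24 * 10 ^ 6)" for k
    unfolding graph_family_def by (rule cubic_graph.cheeger_lower[OF cubic_family])
  then show "expander_family graph_family"
    unfolding expander_family_def by (intro exI[of _ "1 / (24 * 10 ^ 6)"]) simp
  show "irreducible_chain (pverts (graph_family k)) (srw (graph_family k))" for k
    unfolding verts unfolding graph_family_def by (rule cubic_graph.irreducible[OF cubic_family])
  show "aperiodic_chain (pverts (graph_family k)) (srw (graph_family k))" for k
    unfolding verts unfolding graph_family_def by (rule cubic_graph.aperiodic[OF cubic_family])
  show "\<not> tv_cutoff (\<lambda>k. pverts (graph_family k)) (\<lambda>k. srw (graph_family k))"
    by (rule not_cutoff_graph_family)
qed

end
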